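(* Let $a,b,n$ be positive integers with $1\le b<a\le n$, let $A=\{a,b\}$ and let $\sigma_A=ab\,\eta_{1,b-1}\eta_{b+1,a-1}\eta_{a+1,n}\in\mathfrak S_n$. Then, for $j\in[n]$: (a) If $j=1$ and $b=1$, then $S(\sigma_A)_j^*=(-1)^{n+1}(2\sqcup\!\sqcup \delta_{n,4})3$. (b) If $j=1$ and $b=2$, then $S(\sigma_A)_j^*=(-1)^{n}(32\sqcup\!\sqcup \delta_{n,5})4$. (c) If $j=1$ and $b\ge 3$, then $S(\sigma_A)_j^*=(-1)^{n+b+1}\big[(b+1)\eta_{2,b-1}\sqcup\!\sqcup \delta_{n,b+2}\big]b+\sum_{k=4}^{b}(-1)^{n+k}\big(k\,\eta_{2,k-1}\sqcup\!\sqcup \delta_{n,k+1}\big)$. (d) If $j=2$, $b=1$ and $a=2$, then $S(\sigma_A)_j^*=(-1)^{n}(1\sqcup\!\sqcup \delta_{n,3})$. (e) If $j=2$, $b=1$ and $a\ge 3$, then $S(\sigma_A)_j^*=(-1)^{n}\big(1\sqcup\!\sqcup \delta_{n,3}+31\sqcup\!\sqcup \delta_{n,4}\big)$. (f) If $j=2$ and $b=2$, then $S(\sigma_A)_j^*=(-1)^{n+1}\big[1\sqcup\!\sqcup (3\sqcup\!\sqcup\delta_{n,5})4\big]$. (g) If $j=2$ and $b\ge3$, then $S(\sigma_A)_j^*=(-1)^{n+1}\big[1\sqcup\!\sqcup(3\sqcup\!\sqcup \delta_{n,5})4+431\sqcup\!\sqcup \delta_{n,5}\big]$. (h) If $3\le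 j\le b-1$, then $S(\sigma_A)_j^*=(-1)^{n+j+1}\Big[\big(1\sqcup\!\sqcup (j-1)\eta_{2,j-2}-\delta_{j-1,j-2}\eta_{1,j-3}\big)\sqcup\!\sqcup \delta_{n,j+1}+1\sqcup\!\sqcup (j+1)\eta_{2,j-1}\sqcup\!\sqcup \delta_{n,j+2}+\delta_{j+2,j+1}\eta_{1,j-1}\sqcup\!\sqcup \delta_{n,j+3}\Big]$. (i) If $3\le j=b$, then $S(\sigma_A)_j^*=(-1)^{n+j+1}\Big[\big(1\sqcup\!\sqcup (j-1)\eta_{2,j-2}-\delta_{j-1,j-2}\eta_{1,j-3}\big)\sqcup\!\sqcup \delta_{n,j+1}+1\sqcup\!\sqcup (j+1)\eta_{2,j-1}\sqcup\!\sqcup \delta_{n,j+2}\Big]$. (j) If $3\le j=b+1$ and $a=b+1$, then $S(\sigma_A)_j^*=(-1)^{n+j+1}\Big[\big(1\sqcup\!\sqcup (j-1)\eta_{2,j-2}-\delta_{j-1,j-2}\eta_{1,j-3}\big)\sqcup\!\sqcup \delta_{n,j+1}\Big]$. (k) If $3\le j=b+1$ and $a\ge b+2$, then $S(\sigma_A)_j^*=(-1)^{n+j+1}\Big[\big(1\sqcup\!\sqcup (j-1)\eta_{2,j-2}-\delta_{j-1,j-2}\eta_{1,j-3}\big)\sqcup\!\sqcup \delta_{n,j+1}-(j+1)(j-1)\eta_{1,j-2}\sqcup\!\sqcup \delta_{n,j+2}\Big]$. (l) If $b+2\le j\le n$ and $j\le a-1$, then $S(\sigma_A)_j^*=(-1)^{n+j}\Big[(j-1)b\,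 \eta_{1,b-1}\eta_{b+1,j-2}\sqcup\!\sqcup \delta_{n,j+1}+(j+1)b\,\eta_{1,b-1}\eta_{b+1,j-1}\sqcup\!\sqcup \delta_{n,j+2}\Big]$. (m) If $b+2\le j\le n$ and $j=a$, then $S(\sigma_A)_j^*=(-1)^{n+j}\big[(j-1)b\, \eta_{1,b-1}\eta_{b+1,j-2}\sqcup\!\sqcup \delta_{n,j+1}\big]$. (n) If $b+2\le j\le n$ and $j\ge a+1$, then $S(\sigma_A)_j^*=0$. In particular, $S(\sigma_A)_j^*$ is independent of $a$ for every $j$ with $1\le j\le b$.
   Context: Let $\Bbbk$ be a field of characteristic zero. For $n\ge0$ let $\mathfrak S_n$ be the group of permutations of $[n]=\{1,\dots,n\}$, each written in one-line notation as a word $\sigma_1\sigma_2\cdots\sigma_n$ over the positive integers; $\mathfrak S_0=\{\emptyset\}$ where $\emptyset$ is the empty word. All identities take place in the $\Bbbk$-vector space with basis all finite words over the positive integers. Concatenation of words is extended bilinearly. The shuffle product $\sqcup\!\sqcup$ is the bilinear product with the empty word as unit and $au\sqcup\!\sqcup bv=a(u\sqcup\!\sqcup bv)+b(au\sqcup\!\sqcup v)$ for letters $a,b$ and words $u,v$; it is associative. Concatenation binds more tightly than shuffle (e.g. $uv\sqcup\!\sqcup w=(uv)\sqcup\!\sqcup w$, and $(u\sqcup\!\sqcup v)c$ is the concatenation of every term of $u\sqcup\!\sqcup v$ with $c$). In expressions like $(j+1)\eta_{2,j-1}$ or $431$, a parenthesized integer or a digit denotes a single letter. For a word $w$ with distinct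 letters, $\mathrm{st}(w)$ is the unique permutation with the same relative order of letters; $w+m$ adds $m$ to every letter. The Malvenuto–Reutenauer Hopf algebra $\bigoplus_{n\ge0}\Bbbk\mathfrak S_n$ has product $\pi\cdot\sigma=\pi\sqcup\!\sqcup(\sigma+m)$ for $\pi\in\mathfrak S_m$, coproduct $\Delta(\pi)=\sum_{i=0}^m\mathrm{st}(\pi_1\cdots\pi_i)\otimes\mathrm{st}(\pi_{i+1}\cdots\pi_m)$, and antipode $S$ determined by $S(\emptyset)=\emptyset$ and, for $\sigma\in\mathfrak S_n$, $n\ge1$, $S(\sigma)=-\sum_{i=0}^{n-1}S(\mathrm{st}(\sigma_1\cdots\sigma_i))\cdot\mathrm{st}(\sigma_{i+1}\cdots\sigma_n)$. For $\sigma\in\mathfrak S_n$ and $j\in[n]$, $S(\sigma)_j$ denotes the sum (with coefficients) of those terms of $S(\sigma)$ whose last letter is $j$, and $S(\sigma)_j^*$ is obtained from $S(\sigma)_j$ by deleting the final letter $j$ from each term, so $S(\sigma)=\sum_j S(\sigma)_j^*\,j$. For integers $k,l$: $\eta_{k,l}=k(k+1)\cdots l$ if $k\le l$, $\eta_{k,l}=\emptyset$ if $k=l+1$, and $\eta_{k,l}=0$ (the zero vector) if $k\ge l+2$; similarly $\delta_{l,k}=l(l-1)\cdots k$ if $k\le l$, $\delta_{l,k}=\emptyset$ if $k=l+1$, $\delta_{l,k}=0$ if $k\ge l+2$. By bilinearity, any concatenation or shuffle involving a factor $0$ is $0$. An empty sum $\sum_{i=j}^k$ with $k<j$ is $0$.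 *)

theory Defs
  imports Complex_Main "HOL-Library.Poly_Mapping"
begin

(* Words are integer lists, so the vectors below live in the space spanned by all words
   over int; the words over the positive integers span a subspace closed under every
   operation used here. Integer letters make expressions such as j - 3 exact. *)

type_synonym 'k wvec = "int list \<Rightarrow>\<^sub>0 'k"

definition word :: "int list \<Rightarrow> 'k::comm_ring_1 wvec" where
  "word w = Poly_Mapping.single w 1"

definition scale :: "'k::comm_ring_1 \<Rightarrow> 'k wvec \<Rightarrow> 'k wvec"  (infixr "\<odot>" 72) where
  "c \<odot> x = Poly_Mapping.map ((*) c) x"

definition lin_ext :: "(int list \<Rightarrow> 'k wvec) \<Rightarrow> 'k::comm_ring_1 wvec \<Rightarrow> 'k wvec" where
  "lin_ext f x = (\<Sum>u\<in>Poly_Mapping.keys x. Poly_Mapping.lookup x u \<odot> f u)"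

definition bilin_ext ::
    "(int list \<Rightarrow> int list \<Rightarrow> 'k wvec) \<Rightarrow> 'k::comm_ring_1 wvec \<Rightarrow> 'k wvec \<Rightarrow> 'k wvec" where
  "bilin_ext f x y = lin_ext (\<lambda>u. lin_ext (f u) y) x"

definition cat :: "'k::comm_ring_1 wvec \<Rightarrow> 'k wvec \<Rightarrow> 'k wvec"  (infixr "\<cdot>" 80) where
  "x \<cdot> y = bilin_ext (\<lambda>u v. word (u @ v)) x y"

fun shuffle_words :: "int list \<Rightarrow> int list \<Rightarrow> 'k::comm_ring_1 wvec" where
  "shuffle_words [] v = word v"
| "shuffle_words u [] = word u"
| "shuffle_words (a # u) (b # v) =
     word [a] \<cdot> shuffle_words u (b # v) + word [b] \<cdot> shuffle_words (a # u) v"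

definition shuffle :: "'k::comm_ring_1 wvec \<Rightarrow> 'k wvec \<Rightarrow> 'k wvec"  (infixl "\<squnion>" 75) where
  "x \<squnion> y = bilin_ext shuffle_words x y"

definition is_perm_word :: "int list \<Rightarrow> bool" where
  "is_perm_word w \<longleftrightarrow> distinct w \<and> set w = {1..int (length w)}"

definition st :: "int list \<Rightarrow> int list" where
  "st w = map (\<lambda>x. int (card {y \<in> set w. y \<le> x})) w"

lemma length_st [simp]: "length (st w) = length w"
  by (simp add: st_def)

definition mr_prod :: "'k::comm_ring_1 wvec \<Rightarrow> 'k wvec \<Rightarrow> 'k wvec" where
  "mr_prod = bilin_ext (\<lambda>p q. shuffle_words p (map (\<lambda>x. x + int (length p)) q))"

(* Only the values on words of permutations are meaningful. *)
function antipode_word :: "int list \<Rightarrow> 'k::comm_ring_1 wvec" where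
  "antipode_word w =
     (if w = [] then word []
      else - (\<Sum>i\<in>{0..<length w}. mr_prod (antipode_word (st (take i w))) (word (st (drop i w)))))"
  by auto
termination
  by (relation "Wellfounded.measure length") auto

declare antipode_word.simps [simp del]

definition antipode :: "'k::comm_ring_1 wvec \<Rightarrow> 'k wvec" where
  "antipode = lin_ext antipode_word"

definition last_part :: "int \<Rightarrow> 'k::comm_ring_1 wvec \<Rightarrow> 'k wvec" where
  "last_part j = lin_ext (\<lambda>w. if w \<noteq> [] \<and> last w = j then word w else 0)"

definition delete_last :: "'k::comm_ring_1 wvec \<Rightarrow> 'k wvec" where
  "delete_last = lin_ext (\<lambda>w. word (butlast w))"

(* For a permutation sigma this is S(sigma)_j^*. *)
definition S_star :: "int \<Rightarrow> 'k::comm_ring_1 wvec \<Rightarrow> 'k wvec" where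
  "S_star j x = delete_last (last_part j (antipode x))"

(* eta k l is k(k+1)...l and delta l k is l(l-1)...k; for k = l + 1 the list [k..l] is empty. *)
definition eta :: "int \<Rightarrow> int \<Rightarrow> 'k::comm_ring_1 wvec"  ("\<eta>") where
  "\<eta> k l = (if k \<le> l + 1 then word [k..l] else 0)"

definition delta :: "int \<Rightarrow> int \<Rightarrow> 'k::comm_ring_1 wvec"  ("\<delta>") where
  "\<delta> l k = (if k \<le> l + 1 then word (rev [k..l]) else 0)"

definition sigma_A :: "int \<Rightarrow> int \<Rightarrow> int \<Rightarrow> 'k::comm_ring_1 wvec" where
  "sigma_A a b n = word [a, b] \<cdot> \<eta> 1 (b - 1) \<cdot> \<eta> (b + 1) (a - 1) \<cdot> \<eta> (a + 1) n"


lemma lookup_scale [simp]: "Poly_Mapping.lookup (c \<odot> x) w = c * Poly_Mapping.lookup x w"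
  by (simp add: scale_def Poly_Mapping.map.rep_eq when_def)

lemma one_scale [simp]: "1 \<odot> x = x"
  by (rule poly_mapping_eqI) simp

lemma lin_ext_word [simp]: "lin_ext f (word w) = f w"
  by (simp add: lin_ext_def word_def)

lemma cat_word [simp]: "word u \<cdot> word v = word (u @ v)"
  by (simp add: cat_def bilin_ext_def)

lemma shuffle_word [simp]: "word u \<squnion> word v = shuffle_words u v"
  by (simp add: shuffle_def bilin_ext_def)

lemma antipode_of_word [simp]: "antipode (word w) = antipode_word w"
  by (simp add: antipode_def)

(* For distinct letters, st is the unique permutation with the same relative order. *)

lemma card_le_less_iff:
  fixes A :: "int set"
  assumes "finite A" "x \<in> A" "y \<in> A"
  shows "card {z \<in> A. z \<le> x} < card {z \<in> A. z \<le> y} \<longleftrightarrow> x < y"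
proof
  assume "x < y"
  hence "{z \<in> A. z \<le> x} \<subseteq> {z \<in> A. z \<le> y}"
    "y \<in> {z \<in> A. z \<le> y}" "y \<notin> {z \<in> A. z \<le> x}" using assms by auto
  hence "{z \<in> A. z \<le> x} \<subset> {z \<in> A. z \<le> y}" by blast
  thus "card {z \<in> A. z \<le> x} < card {z \<in> A. z \<le> y}"
    using assms by (intro psubset_card_mono) auto
next
  assume less: "card {z \<in> A. z \<le> x} < card {z \<in> A. z \<le> y}"
  show "x < y"
  proof (rule ccontr)
    assume "\<not> x < y"
    hence "{z \<in> A. z \<le> y} \<subseteq> {z \<in> A. z \<le> x}" by auto
    hence "card {z \<in> A. z \<le> y} \<le> card {z \<in> A. z \<le> x}"
      using assms by (intro card_mono) auto
    thus False using less by simp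
  qed
qed

lemma st_order:
  assumes "i < length w" "j < length w"
  shows "st w ! i < st w ! j \<longleftrightarrow> w ! i < w ! j"
  using assms card_le_less_iff[of "set w" "w ! i" "w ! j"] by (simp add: st_def)

lemma is_perm_word_st:
  assumes "distinct w"
  shows "is_perm_word (st w)"
proof -
  have d: "distinct (st w)"
    unfolding distinct_conv_nth
  proof (intro allI impI)
    fix i j assume ij: "i < length (st w)" "j < length (st w)" "i \<noteq> j"
    hence "w ! i \<noteq> w ! j" using assms by (simp add: nth_eq_iff_index_eq)
    thus "st w ! i \<noteq> st w ! j" using st_order[of i w j] st_order[of j w i] ij
      by (auto simp: neq_iff)
  qed
  have sub: "set (st w) \<subseteq> {1..int (length (st w))}"
  proof
    fix t assume "t \<in> set (st w)"
    then obtain x where x: "x \<in> set w" "t = int (card {y \<in> set w. y \<le> x})"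
      by (auto simp: st_def)
    have "card {y \<in> set w. y \<le> x} \<le> card (set w)" by (intro card_mono) auto
    also have "\<dots> \<le> length w" by (rule card_length)
    finally have "card {y \<in> set w. y \<le> x} \<le> length w" .
    moreover have "card {y \<in> set w. y \<le> x} > 0" using x by (auto simp: card_gt_0_iff)
    ultimately show "t \<in> {1..int (length (st w))}" using x by simp
  qed
  have "card (set (st w)) = card {1..int (length (st w))}"
    using distinct_card[OF d] by simp
  with sub have "set (st w) = {1..int (length (st w))}"
    by (intro card_subset_eq) auto
  with d show ?thesis by (simp add: is_perm_word_def)
qed

lemma st_perm_word:
  assumes "is_perm_word w"
  shows "st w = w"
proof (unfold st_def, rule map_idI)
  fix x assume x: "x \<in> set w"
  hence "{y \<in> set w. y \<le> x} = {1..x}" using assms by (auto simp: is_perm_word_def)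
  thus "int (card {y \<in> set w. y \<le> x}) = x" using x assms by (simp add: is_perm_word_def)
qed

lemma st_cong:
  assumes len: "length v = length w"
    and ord: "\<And>i j. i < length w \<Longrightarrow> j < length w \<Longrightarrow> v ! i < v ! j \<longleftrightarrow> w ! i < w ! j"
    and dist: "distinct v" "distinct w"
  shows "st v = st w"
proof -
  have rank: "card {y \<in> set u. y \<le> u ! i} = card {k. k < length u \<and> u ! k \<le> u ! i}"
    if "distinct u" for u :: "int list" and i
  proof -
    have "{y \<in> set u. y \<le> u ! i} = (!) u ` {k. k < length u \<and> u ! k \<le> u ! i}"
      by (auto simp: in_set_conv_nth)
    moreover have "inj_on ((!) u) {k. k < length u \<and> u ! k \<le> u ! i}"
      using that by (auto simp: inj_on_def nth_eq_iff_index_eq)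
    ultimately show ?thesis by (simp add: card_image)
  qed
  show ?thesis
  proof (rule nth_equalityI)
    fix i assume "i < length (st v)"
    hence i: "i < length v" by simp
    have "{k. k < length v \<and> v ! k \<le> v ! i} = {k. k < length w \<and> w ! k \<le> w ! i}"
      using ord[of i] i len by (auto simp: not_less[symmetric])
    thus "st v ! i = st w ! i"
      using i len by (simp add: st_def rank dist)
  qed (use len in simp)
qed

lemma st_unique:
  assumes "distinct w" "is_perm_word v" "length v = length w"
    and "\<And>i j. i < length w \<Longrightarrow> j < length w \<Longrightarrow> v ! i < v ! j \<longleftrightarrow> w ! i < w ! j"
  shows "v = st w"
  using st_cong[of v w] st_perm_word[of v] assms by (simp add: is_perm_word_def)

lemma sigma_A_word:
  assumes "1 \<le> b" "b < a" "a \<le> n"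
  shows "sigma_A a b n = word ([a, b] @ [1..b - 1] @ [b + 1..a - 1] @ [a + 1..n])"
  using assms by (simp add: sigma_A_def eta_def)

lemma is_perm_word_sigma_A:
  assumes "1 \<le> b" "b < a" "a \<le> n"
  shows "is_perm_word ([a, b] @ [1..b - 1] @ [b + 1..a - 1] @ [a + 1..n])"
  using assms by (auto simp: is_perm_word_def)

end

(* The prefixes of sigma_A standardize to words of the same shape and the suffixes standardize to
   increasing words, so the recursion for S becomes
     S(sigma_n) = X_n - sum_{2 <= i < n} S(sigma_i) sh eta_{i+1,n},
   where sigma_i is the standardized prefix of length i, and X_i = 1 sh (tail of sigma_i,
   standardized and shifted by 1) - sigma_i collects the terms of the two trivial cuts.
   Since eta and signed delta are inverse to each other, i.e.
     sum_{k <= i <= n} (-1)^i delta_{i,k+1} sh eta_{i+1,n} = 0   for k < n,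
   this inverts to S(sigma_n) = sum_{2 <= k <= n} (-1)^(n+k) X_k sh delta_{n,k+1}.
   Taking the terms with last letter j and deleting that letter is a derivation for the shuffle
   product. For j >= 2 it kills all but a few summands; for j = 1 the summands telescope. *)
theory Submission
  imports Defs
begin

section \<open>Linear algebra of words\<close>

text \<open>Brings in the library theory of module homomorphisms: once an operation is shown linear,
  its rules for sums, differences and scalars come from the locale.\<close>

interpretation wvec: module "(\<odot>) :: 'k::comm_ring_1 \<Rightarrow> 'k wvec \<Rightarrow> 'k wvec"
  by unfold_locales (auto intro!: poly_mapping_eqI simp: lookup_add algebra_simps)

abbreviation wlinear :: "('k::comm_ring_1 wvec \<Rightarrow> 'k wvec) \<Rightarrow> bool" where
  "wlinear \<equiv> module_hom (\<odot>) (\<odot>)"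

lemma wlinearI:
  assumes "\<And>x y. f (x + y) = f x + f y" "\<And>c x. f (c \<odot> x) = c \<odot> f x"
  shows "wlinear f"
  using assms by unfold_locales auto

text \<open>Words outside the support have coefficient 0. A common finite index set lets vectors
  with different supports be compared term by term.\<close>

lemma lin_ext_superset:
  assumes "finite A" "Poly_Mapping.keys x \<subseteq> A"
  shows "lin_ext f x = (\<Sum>u\<in>A. Poly_Mapping.lookup x u \<odot> f u)"
  unfolding lin_ext_def
  using assms by (intro sum.mono_neutral_left) (auto simp: in_keys_iff)

lemma wlinear_lin_ext: "wlinear (lin_ext (f :: _ \<Rightarrow> 'a::comm_ring_1 wvec))"
proof (rule wlinearI)
  fix x y :: "'a wvec"
  let ?A = "Poly_Mapping.keys x \<union> Poly_Mapping.keys y"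
  have "Poly_Mapping.keys (x + y) \<subseteq> ?A"
    by (rule Poly_Mapping.keys_add)
  then show "lin_ext f (x + y) = lin_ext f x + lin_ext f y"
    by (simp add: lin_ext_superset[of ?A] lookup_add wvec.scale_left_distrib sum.distrib)
next
  fix c and x :: "'a wvec"
  have "Poly_Mapping.keys (c \<odot> x) \<subseteq> Poly_Mapping.keys x"
    by (auto simp: in_keys_iff)
  then show "lin_ext f (c \<odot> x) = c \<odot> lin_ext f x"
    by (simp add: lin_ext_superset[of "Poly_Mapping.keys x"] wvec.scale_sum_right)
qed

lemma lin_ext_word_id: "lin_ext word x = x"
proof (rule poly_mapping_eqI)
  fix w
  have "Poly_Mapping.lookup (lin_ext word x) w =
      (\<Sum>u\<in>Poly_Mapping.keys x. Poly_Mapping.lookup x u * (1 when u = w))"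
    by (simp add: lin_ext_def lookup_sum word_def lookup_single)
  also have "\<dots> = Poly_Mapping.lookup x w"
    by (auto simp: when_def in_keys_iff sum.delta if_distrib[of "times _"] cong: if_cong)
  finally show "Poly_Mapping.lookup (lin_ext word x) w = Poly_Mapping.lookup x w" .
qed

text \<open>Words span the space. Every bilinear or trilinear identity below is reduced to words
  with this rule, one argument at a time.\<close>

lemma wlinear_eqI:
  assumes f: "wlinear f" and g: "wlinear g" and eq: "\<And>w. f (word w) = g (word w)"
  shows "f x = g x"
proof -
  have "f (lin_ext word x) = g (lin_ext word x)"
    by (simp add: lin_ext_def module_hom.sum[OF f] module_hom.sum[OF g]
        module_hom.scale[OF f] module_hom.scale[OF g] eq)
  then show ?thesis by (simp add: lin_ext_word_id)
qed

section \<open>Linearity of concatenation and shuffle in each argument\<close>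

lemma wlinear_bilin_ext_left: "wlinear (\<lambda>x. bilin_ext f x y)"
  unfolding bilin_ext_def by (rule wlinear_lin_ext)

lemma wlinear_bilin_ext_right: "wlinear (\<lambda>y. bilin_ext f x y)"
proof (rule wlinearI)
  note h = wlinear_lin_ext[of "f _"]
  show "bilin_ext f x (y + z) = bilin_ext f x y + bilin_ext f x z" for y z
    by (simp add: bilin_ext_def lin_ext_def[of _ x] module_hom.add[OF h]
        wvec.scale_right_distrib sum.distrib)
  show "bilin_ext f x (c \<odot> y) = c \<odot> bilin_ext f x y" for c y
    by (simp add: bilin_ext_def lin_ext_def[of _ x] module_hom.scale[OF h]
        wvec.scale_sum_right mult.commute)
qed

lemma wlinear_id: "wlinear (\<lambda>x. x)"
  by (rule wlinearI) auto

lemma wlinear_comp: "wlinear f \<Longrightarrow> wlinear g \<Longrightarrow> wlinear (\<lambda>x. f (g x))"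
  by (rule wlinearI) (auto simp: module_hom.add module_hom.scale)

lemma wlinear_add: "wlinear f \<Longrightarrow> wlinear g \<Longrightarrow> wlinear (\<lambda>x. f x + g x)"
  by (rule wlinearI) (auto simp: module_hom.add module_hom.scale wvec.scale_right_distrib)

lemma wlinear_shuffle_left: "wlinear (\<lambda>x. x \<squnion> y)"
  unfolding shuffle_def by (rule wlinear_bilin_ext_left)

lemma wlinear_shuffle_right: "wlinear (\<lambda>y. x \<squnion> y)"
  unfolding shuffle_def by (rule wlinear_bilin_ext_right)

lemma wlinear_cat_left: "wlinear (\<lambda>x. x \<cdot> y)"
  unfolding cat_def by (rule wlinear_bilin_ext_left)

lemma wlinear_cat_right: "wlinear (\<lambda>y. x \<cdot> y)"
  unfolding cat_def by (rule wlinear_bilin_ext_right)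

text \<open>Each operation is composed with an arbitrary inner linear map, so the rules peel nested
  expressions from the outside.\<close>

lemmas wlinear_intros = wlinear_id wlinear_add
  wlinear_comp[OF wlinear_shuffle_left] wlinear_comp[OF wlinear_shuffle_right]
  wlinear_comp[OF wlinear_cat_left] wlinear_comp[OF wlinear_cat_right]

lemmas shuffle_left_hom = module_hom.zero[OF wlinear_shuffle_left]
  module_hom.add[OF wlinear_shuffle_left] module_hom.diff[OF wlinear_shuffle_left]
  module_hom.neg[OF wlinear_shuffle_left] module_hom.scale[OF wlinear_shuffle_left]
  module_hom.sum[OF wlinear_shuffle_left]

lemmas shuffle_right_hom = module_hom.zero[OF wlinear_shuffle_right]
  module_hom.add[OF wlinear_shuffle_right] module_hom.diff[OF wlinear_shuffle_right]
  module_hom.neg[OF wlinear_shuffle_right] module_hom.scale[OF wlinear_shuffle_right]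
  module_hom.sum[OF wlinear_shuffle_right]

lemmas cat_hom = module_hom.zero[OF wlinear_cat_left] module_hom.zero[OF wlinear_cat_right]
  module_hom.add[OF wlinear_cat_left] module_hom.add[OF wlinear_cat_right]

lemma cat_assoc: "(x \<cdot> y) \<cdot> z = x \<cdot> (y \<cdot> z)"
proof -
  have 1: "(word u \<cdot> word v) \<cdot> z = word u \<cdot> (word v \<cdot> z)" for u v
    by (rule wlinear_eqI[where x = z]; (intro wlinear_intros)?; simp)
  have 2: "(word u \<cdot> y) \<cdot> z = word u \<cdot> (y \<cdot> z)" for u
    by (rule wlinear_eqI[where x = y]; (intro wlinear_intros)?; simp add: 1 del: cat_word)
  show ?thesis
    by (rule wlinear_eqI[where x = x]; (intro wlinear_intros)?; simp add: 2 del: cat_word)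
qed

section \<open>Shuffle products\<close>

lemma shuffle_words_Nil2 [simp]: "shuffle_words u [] = word u"
  by (cases u) auto

lemma shuffle_Nil [simp]: "word [] \<squnion> x = x" "x \<squnion> word [] = x"
  by (rule wlinear_eqI[where x = x]; simp add: wlinear_intros)+

lemma shuffle_letters_left:
  "word [a] \<cdot> x \<squnion> word [b] \<cdot> y = word [a] \<cdot> (x \<squnion> word [b] \<cdot> y) + word [b] \<cdot> (word [a] \<cdot> x \<squnion> y)"
proof -
  have 1: "word [a] \<cdot> word u \<squnion> word [b] \<cdot> y
      = word [a] \<cdot> (word u \<squnion> word [b] \<cdot> y) + word [b] \<cdot> (word [a] \<cdot> word u \<squnion> y)" for u
    by (rule wlinear_eqI[where x = y]; (intro wlinear_intros)?; simp)
  show ?thesis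
    by (rule wlinear_eqI[where x = x]; (intro wlinear_intros)?; rule 1)
qed

text \<open>Splitting off first letters commutes with splitting off last letters, so the defining
  recursion has a mirror image. The base cases, where one word is a single letter, need inductions
  of their own.\<close>

lemma shuffle_words_snoc:
  "shuffle_words (u @ [c]) (v @ [d]) =
     shuffle_words u (v @ [d]) \<cdot> word [c] + shuffle_words (u @ [c]) v \<cdot> word [d]"
proof (induction u v rule: shuffle_words.induct)
  case (1 v)
  show ?case
    by (induction v) (auto simp: cat_hom cat_assoc algebra_simps)
next
  case (2 a u)
  show ?case
    by (induction u arbitrary: a) (auto simp: cat_hom cat_assoc algebra_simps)
next
  case (3 a u b v)
  then show ?case by (auto simp: cat_hom cat_assoc algebra_simps)
qed

lemma shuffle_letters_right:
  "x \<cdot> word [c] \<squnion> y \<cdot> word [d] = (x \<squnion> y \<cdot> word [d]) \<cdot> word [c] + (x \<cdot> word [c] \<squnion> y) \<cdot> word [d]"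
proof -
  have 1: "word u \<cdot> word [c] \<squnion> y \<cdot> word [d]
      = (word u \<squnion> y \<cdot> word [d]) \<cdot> word [c] + (word u \<cdot> word [c] \<squnion> y) \<cdot> word [d]" for u
    by (rule wlinear_eqI[where x = y]; (intro wlinear_intros)?; simp add: shuffle_words_snoc)
  show ?thesis
    by (rule wlinear_eqI[where x = x]; (intro wlinear_intros)?; rule 1)
qed

text \<open>Induction on the total length: both sides are sorted by their first letter, which comes
  from \<open>u\<close>, \<open>v\<close> or \<open>w\<close>, and each of the three groups is an
  instance of the claim for shorter words.\<close>

lemma shuffle_assoc_words:
  "(word u \<squnion> word v) \<squnion> word w = word u \<squnion> (word v \<squnion> (word w :: 'k::comm_ring_1 wvec))"
proof (induction "length u + length v + length w" arbitrary: u v w rule: less_induct)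
  case less
  show ?case
  proof (cases "u = [] \<or> v = [] \<or> w = []")
    case True
    then show ?thesis by (auto simp del: shuffle_word)
  next
    case False
    then obtain a u' b v' c w' where eq: "u = a # u'" "v = b # v'" "w = c # w'"
      by (metis neq_Nil_conv)
    have Cons: "word (x # xs) = word [x] \<cdot> (word xs :: 'k wvec)" for x xs by simp
    note IH = less(1)[of u' v w, unfolded eq] less(1)[of u v' w, unfolded eq]
      less(1)[of u v w', unfolded eq]
    \<comment> \<open>On the left the terms starting with \<open>c\<close> arise in two pieces, and
      only their sum matches the induction hypothesis. That hypothesis is therefore supplied with
      \<open>c\<close> already prefixed.\<close>
    show ?thesis
      using IH(1,2) arg_cong[OF IH(3), of "\<lambda>x. word [c] \<cdot> x"] unfolding eq
      by (simp add: Cons[of a u'] Cons[of b v'] Cons[of c w'] shuffle_letters_left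
        shuffle_left_hom shuffle_right_hom cat_hom algebra_simps del: shuffle_word cat_word)
  qed
qed

lemma shuffle_assoc: "(x \<squnion> y) \<squnion> z = x \<squnion> (y \<squnion> z)"
proof -
  have 1: "(word u \<squnion> word v) \<squnion> z = word u \<squnion> (word v \<squnion> z)" for u v
    by (rule wlinear_eqI[where x = z]; (intro wlinear_intros)?; rule shuffle_assoc_words)
  have 2: "(word u \<squnion> y) \<squnion> z = word u \<squnion> (y \<squnion> z)" for u
    by (rule wlinear_eqI[where x = y]; (intro wlinear_intros)?; rule 1)
  show ?thesis
    by (rule wlinear_eqI[where x = x]; (intro wlinear_intros)?; rule 2)
qed

section \<open>The antipode recursion\<close>

(* mr_prod shifts by the length of each word of its first argument; on homogeneous vectors the
   shift is uniform, so mr_prod becomes a single shuffle. *)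
definition homogeneous :: "nat \<Rightarrow> 'k::comm_ring_1 wvec \<Rightarrow> bool" where
  "homogeneous m x \<longleftrightarrow> (\<forall>w. Poly_Mapping.lookup x w \<noteq> 0 \<longrightarrow> length w = m)"

lemma homogeneous_0 [simp]: "homogeneous m 0"
  by (simp add: homogeneous_def)

lemma homogeneous_word: "length w = m \<Longrightarrow> homogeneous m (word w)"
  by (auto simp: homogeneous_def word_def lookup_single when_def split: if_splits)

lemma homogeneous_add: "homogeneous m x \<Longrightarrow> homogeneous m y \<Longrightarrow> homogeneous m (x + y)"
  unfolding homogeneous_def lookup_add by (metis add.right_neutral)

lemma homogeneous_uminus: "homogeneous m x \<Longrightarrow> homogeneous m (- x)"
  by (simp add: homogeneous_def)

lemma homogeneous_scale: "homogeneous m x \<Longrightarrow> homogeneous m (c \<odot> x)"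
  unfolding homogeneous_def lookup_scale by (metis mult_zero_right)

lemma homogeneous_sum: "(\<And>i. i \<in> A \<Longrightarrow> homogeneous m (f i)) \<Longrightarrow> homogeneous m (sum f A)"
  by (induction A rule: infinite_finite_induct) (auto intro: homogeneous_add)

lemma homogeneous_lin_ext:
  assumes "homogeneous m x" "\<And>w. length w = m \<Longrightarrow> homogeneous l (f w)"
  shows "homogeneous l (lin_ext f x)"
  using assms unfolding lin_ext_def homogeneous_def[of m]
  by (intro homogeneous_sum homogeneous_scale) (auto simp: in_keys_iff)

lemma homogeneous_cat:
  assumes "homogeneous l x" "homogeneous m y"
  shows "homogeneous (l + m) (x \<cdot> y)"
  unfolding cat_def bilin_ext_def
  using assms by (intro homogeneous_lin_ext homogeneous_word) auto

lemma homogeneous_shuffle_words: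
  "length u + length v = m \<Longrightarrow> homogeneous m (shuffle_words u v)"
proof (induction u v arbitrary: m rule: shuffle_words.induct)
  case (3 a u b v)
  have "homogeneous (1 + (m - 1)) (word [a] \<cdot> shuffle_words u (b # v) :: 'a wvec)"
    using 3 by (intro homogeneous_cat homogeneous_word) auto
  moreover have "homogeneous (1 + (m - 1)) (word [b] \<cdot> shuffle_words (a # u) v :: 'a wvec)"
    using 3 by (intro homogeneous_cat homogeneous_word) auto
  ultimately show ?case
    using 3(3) by (auto intro!: homogeneous_add)
qed (auto intro: homogeneous_word)

lemma homogeneous_shuffle:
  assumes "homogeneous l x" "homogeneous m y"
  shows "homogeneous (l + m) (x \<squnion> y)"
  unfolding shuffle_def bilin_ext_def
  using assms by (intro homogeneous_lin_ext homogeneous_shuffle_words) auto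

lemma mr_prod_homogeneous:
  assumes "homogeneous m x"
  shows "mr_prod x (word q) = x \<squnion> word (map (\<lambda>i. i + int m) q)"
  using assms unfolding mr_prod_def shuffle_def bilin_ext_def lin_ext_def[of _ x] homogeneous_def
  by (intro sum.cong) (auto simp: in_keys_iff)

text \<open>By induction the cut after \<open>i\<close> letters contributes a shuffle of degree
  \<open>i\<close> with a word of length \<open>length w - i\<close>. This makes the shift in every
  term of the recursion uniform.\<close>

lemma homogeneous_antipode_word: "homogeneous (length w) (antipode_word w :: 'k::comm_ring_1 wvec)"
proof (induction w rule: length_induct)
  case (1 w)
  have "homogeneous (length w)
      (mr_prod (antipode_word (st (take i w))) (word (st (drop i w))) :: 'k wvec)"
    if "i < length w" for i
  proof -
    have h: "homogeneous i (antipode_word (st (take i w)) :: 'k wvec)"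
      using 1[rule_format, of "st (take i w)"] that by simp
    have "homogeneous (i + length (st (drop i w)))
        (mr_prod (antipode_word (st (take i w))) (word (st (drop i w))) :: 'k wvec)"
      unfolding mr_prod_homogeneous[OF h]
      using h by (intro homogeneous_shuffle homogeneous_word) auto
    then show ?thesis using that by simp
  qed
  then show ?case
    by (subst antipode_word.simps)
      (auto intro!: homogeneous_uminus homogeneous_sum homogeneous_word)
qed

lemma antipode_word_rec:
  assumes "w \<noteq> []"
  shows "(antipode_word w :: 'k::comm_ring_1 wvec) =
    - (\<Sum>i\<in>{0..<length w}. antipode_word (st (take i w)) \<squnion>
         word (map (\<lambda>x. x + int i) (st (drop i w))))"
proof -
  have "homogeneous i (antipode_word (st (take i w)) :: 'k wvec)" if "i < length w" for i
    using homogeneous_antipode_word[of "st (take i w)", where 'k = 'k] that by simp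
  then show ?thesis
    using assms by (subst antipode_word.simps) (auto simp: mr_prod_homogeneous intro!: sum.cong)
qed

lemma antipode_word_Nil [simp]: "antipode_word [] = word []"
  by (simp add: antipode_word.simps)

lemma st_Nil [simp]: "st [] = []"
  by (simp add: st_def)

lemma antipode_word_singleton: "antipode_word [1] = - word [1]"
  by (subst antipode_word_rec) (simp_all add: st_perm_word is_perm_word_def)

section \<open>Prefixes and suffixes of the permutation\<close>

lemma st_map:
  assumes "distinct w" "strict_mono_on (set w) f"
  shows "st (map f w) = st w"
  using assms
  by (intro st_cong)
    (auto simp: distinct_map strict_mono_on_imp_inj_on strict_mono_on_less)

lemma st_sorted:
  assumes "sorted_wrt (<) w"
  shows "st w = [1..int (length w)]"
proof (rule st_unique[symmetric])
  fix i j assume ij: "i < length w" "j < length w"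
  show "[1..int (length w)] ! i < [1..int (length w)] ! j \<longleftrightarrow> w ! i < w ! j"
    using ij sorted_wrt_nth_less[OF assms, of i j] sorted_wrt_nth_less[OF assms, of j i]
    by (cases i j rule: linorder_cases) auto
qed (use assms in \<open>auto simp: is_perm_word_def strict_sorted_iff\<close>)

lemma upto_append: "i - 1 \<le> j \<Longrightarrow> j \<le> k \<Longrightarrow> [i..k] = [i..j] @ [j + 1..k]"
  using upto_split2[of i j k] by (cases "i = j + 1") auto

(* The standardization of the first k letters of sigma_A, for k at least 2. *)
definition sigma_word :: "int \<Rightarrow> int \<Rightarrow> int \<Rightarrow> int list" where
  "sigma_word a b k =
     (let a' = min a k; b' = min b (k - 1)
      in [a', b'] @ [1..b' - 1] @ [b' + 1..a' - 1] @ [a' + 1..k])"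

(* The standardization of sigma_word without its first letter, shifted by 1. *)
definition tail_word :: "int \<Rightarrow> int \<Rightarrow> int list" where
  "tail_word b k = (let b' = min b (k - 1) in (b' + 1) # [2..b'] @ [b' + 2..k])"

section \<open>Standardized prefixes, suffixes and tail\<close>

lemma is_perm_word_sigma_word:
  assumes "1 \<le> b" "b < a" "2 \<le> k"
  shows "is_perm_word (sigma_word a b k)"
proof -
  have "1 \<le> min b (k - 1)" "min b (k - 1) < min a k" "min a k \<le> k"
    using assms by auto
  then show ?thesis
    unfolding sigma_word_def Let_def by (rule is_perm_word_sigma_A)
qed

lemma length_sigma_word:
  assumes "1 \<le> b" "b < a" "2 \<le> k"
  shows "length (sigma_word a b k) = nat k"
  using assms by (auto simp: sigma_word_def Let_def)

lemma set_sigma_word: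
  assumes "1 \<le> b" "b < a" "2 \<le> k"
  shows "set (sigma_word a b k) = {1..k}"
  using is_perm_word_sigma_word[OF assms] length_sigma_word[OF assms] assms
  by (simp add: is_perm_word_def)

text \<open>Exhibits the first \<open>k\<close> letters as an order-preserving relabelling
  \<open>f\<close> of \<open>sigma_word a b k\<close>, followed by an increasing rest
  \<open>r\<close>. Both standardizations can then be read off.\<close>

lemma sigma_word_prefix:
  assumes "1 \<le> b" "b < a" "2 \<le> k" "k \<le> n" "a \<le> n"
  obtains f r where "sigma_word a b n = map f (sigma_word a b k) @ r"
    "strict_mono_on {1..k} f" "sorted_wrt (<) r"
proof
  let ?f = "\<lambda>x. if x = min a k then a else if x = min b (k - 1) then b else x"
  let ?r = "if a \<le> k then [k + 1..n] else if b < k then [k..a - 1] @ [a + 1..n]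
    else [k - 1..b - 1] @ [b + 1..a - 1] @ [a + 1..n]"
  have id: "map (\<lambda>x. if x = p then a else if x = q then b else x) [i..j] = [i..j]"
    if "p \<notin> {i..j}" "q \<notin> {i..j}" for p q i j
    using that by (intro map_idI) auto
  \<comment> \<open>If a \<le> k, no letter is relabelled; if b < k < a, the top letter
    \<open>k\<close> stands for \<open>a\<close>; if k \<le> b, the letters \<open>k\<close> and
    \<open>k - 1\<close> stand for \<open>a\<close> and \<open>b\<close>.\<close>
  consider "a \<le> k" | "b < k" "k < a" | "k \<le> b" by linarith
  then show "sigma_word a b n = map ?f (sigma_word a b k) @ ?r"
  proof cases
    case 1
    then have m: "min a k = a" "min b (k - 1) = b" using assms by auto
    show ?thesis unfolding m sigma_word_def Let_def
      using 1 assms upto_append[of "a + 1" k n]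
      by (auto simp: id)
  next
    case 2
    then have m: "min a k = k" "min b (k - 1) = b" using assms by auto
    show ?thesis unfolding m sigma_word_def Let_def
      using 2 assms upto_append[of "b + 1" "k - 1" "a - 1"]
      by (auto simp: id)
  next
    case 3
    then have m: "min a k = k" "min b (k - 1) = k - 1" using assms by auto
    show ?thesis unfolding m sigma_word_def Let_def
      using 3 assms upto_append[of 1 "k - 2" "b - 1"]
      by (auto simp: id)
  qed
  show "strict_mono_on {1..k} ?f"
    using assms by (auto simp: strict_mono_on_def min_def)
  show "sorted_wrt (<) ?r"
    using assms by (auto simp: sorted_wrt_append)
qed

lemma st_take_sigma_word:
  assumes "1 \<le> b" "b < a" "2 \<le> k" "k \<le> n" "a \<le> n"
  shows "st (take (nat k) (sigma_word a b n)) = sigma_word a b k"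
proof -
  obtain f r where fr: "sigma_word a b n = map f (sigma_word a b k) @ r" "strict_mono_on {1..k} f"
    using sigma_word_prefix[OF assms] .
  have p: "is_perm_word (sigma_word a b k)"
    using assms by (simp add: is_perm_word_sigma_word)
  have "st (map f (sigma_word a b k)) = sigma_word a b k"
    using p fr assms
    by (subst st_map) (auto simp: st_perm_word set_sigma_word is_perm_word_def)
  then show ?thesis using assms by (simp add: fr length_sigma_word)
qed

lemma st_drop_sigma_word:
  assumes "1 \<le> b" "b < a" "2 \<le> k" "k \<le> n" "a \<le> n"
  shows "st (drop (nat k) (sigma_word a b n)) = [1..n - k]"
proof -
  obtain f r where fr: "sigma_word a b n = map f (sigma_word a b k) @ r" "sorted_wrt (<) r"
    using sigma_word_prefix[OF assms] .
  have "length r = nat (n - k)"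
    using arg_cong[OF fr(1), of length] assms by (simp add: length_sigma_word)
  then show ?thesis using assms fr st_sorted[of r] by (simp add: length_sigma_word)
qed

lemma map_plus_upto: "map (\<lambda>x. x + c) [i..j] = [i + c..j + c]" for c :: int
  by (rule nth_equalityI) auto

lemma st_tl_sigma_word:
  assumes "1 \<le> b" "b < a" "a \<le> n"
  shows "map (\<lambda>x. x + 1) (st (tl (sigma_word a b n))) = tail_word b n"
proof -
  \<comment> \<open>\<open>?w\<close> is the standardized tail, and \<open>?f\<close> reopens the
    gap left by the removed letter \<open>a\<close>. Since \<open>?w\<close> does not mention
    \<open>a\<close>, neither does \<open>tail_word\<close>.\<close>
  let ?w = "b # [1..b - 1] @ [b + 1..n - 1]" and ?f = "\<lambda>x. if x < a then x else x + 1"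
  have 1: "map ?f [i..a - 1] = [i..a - 1]" for i by (intro map_idI) auto
  have 2: "map ?f [1..b - 1] = [1..b - 1]" using assms by (intro map_idI) auto
  have "map ?f [a..n - 1] = map (\<lambda>x. x + 1) [a..n - 1]" by (intro map_cong) auto
  then have 3: "map ?f [a..n - 1] = [a + 1..n]" by (simp add: map_plus_upto)
  have "tl (sigma_word a b n) = map ?f ?w"
    using assms upto_append[of "b + 1" "a - 1" "n - 1"]
    by (simp add: sigma_word_def Let_def 1 2 3)
  moreover have p: "is_perm_word ?w" using assms by (auto simp: is_perm_word_def)
  have "strict_mono_on (set ?w) ?f" by (auto simp: strict_mono_on_def)
  then have "st (map ?f ?w) = ?w"
    using p st_map[of ?w ?f] st_perm_word[OF p] unfolding is_perm_word_def by metis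
  ultimately have "st (tl (sigma_word a b n)) = ?w" by metis
  then show ?thesis
    using assms by (simp add: tail_word_def Let_def map_plus_upto add.commute)
qed

text \<open>The vector X_k of the overview: the cuts before and after the first letter, with their
  signs.\<close>

definition defect :: "int \<Rightarrow> int \<Rightarrow> int \<Rightarrow> 'k::comm_ring_1 wvec" where
  "defect a b k = word [1] \<squnion> word (tail_word b k) - word (sigma_word a b k)"

lemma antipode_sigma_word_rec_aux:
  assumes "1 \<le> b" "b < a" "a \<le> n"
  shows "(antipode_word (sigma_word a b n) :: 'k::comm_ring_1 wvec) =
    defect a b n - (\<Sum>i\<in>{2..n - 1}. antipode_word (sigma_word a b i) \<squnion> \<eta> (i + 1) n)"
proof -
  let ?w = "sigma_word a b n"
  let ?t = "\<lambda>i. antipode_word (st (take i ?w)) \<squnion> (word (map (\<lambda>x. x + int i) (st (drop i ?w))) :: 'k wvec)"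
  have n: "2 \<le> n" using assms by simp
  \<comment> \<open>The cuts at 0 and 1 form the defect; from 2 on, the prefix is again a
    \<open>sigma_word\<close>.\<close>
  have split: "{0..<nat n} = insert 0 (insert 1 {2..<nat n})" using n by auto
  have p: "is_perm_word ?w" using assms by (simp add: is_perm_word_sigma_word)
  have t0: "?t 0 = word ?w" using st_perm_word[OF p] by simp
  have w1: "?w = a # tl ?w" using assms by (simp add: sigma_word_def)
  have "take 1 ?w = [a]" "drop 1 ?w = tl ?w" by (subst w1, simp)+
  moreover have "st [a] = [1]" using st_sorted[of "[a]"] by simp
  ultimately have t1: "?t 1 = - (word [1] \<squnion> word (tail_word b n))"
    using st_tl_sigma_word[OF assms]
    by (simp add: antipode_word_singleton shuffle_left_hom del: shuffle_word)
  have t: "?t (nat i) = antipode_word (sigma_word a b i) \<squnion> \<eta> (i + 1) n" if "i \<in> {2..n - 1}" for i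
    using that assms by (simp add: st_take_sigma_word st_drop_sigma_word map_plus_upto eta_def add.commute)
  have "antipode_word ?w = - (\<Sum>i\<in>{0..<nat n}. ?t i)"
    using assms n length_sigma_word[of b a n]
    by (subst antipode_word_rec) (auto simp: sigma_word_def)
  also have "\<dots> = defect a b n - (\<Sum>i\<in>{2..<nat n}. ?t i)"
    unfolding split defect_def using t0 t1 by (simp del: shuffle_word)
  also have "(\<Sum>i\<in>{2..<nat n}. ?t i) = (\<Sum>i\<in>{2..n - 1}. ?t (nat i))"
    by (rule sum.reindex_bij_witness[of _ nat int]) auto
  also have "\<dots> = (\<Sum>i\<in>{2..n - 1}. antipode_word (sigma_word a b i) \<squnion> \<eta> (i + 1) n)"
    by (intro sum.cong refl t)
  finally show ?thesis .
qed

text \<open>Removes the bound a \<le> n, because the induction on \<open>n\<close> passes through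
  prefixes too short to contain the true value of \<open>a\<close>. Up to length \<open>n\<close>,
  \<open>sigma_word\<close> only sees \<open>a\<close> and \<open>b\<close> through minima, so both
  may be clamped first.\<close>

lemma antipode_sigma_word_rec:
  assumes "1 \<le> b" "b < a" "2 \<le> n"
  shows "(antipode_word (sigma_word a b n) :: 'k::comm_ring_1 wvec) =
    defect a b n - (\<Sum>i\<in>{2..n - 1}. antipode_word (sigma_word a b i) \<squnion> \<eta> (i + 1) n)"
proof -
  let ?a = "min a n" and ?b = "min b (n - 1)"
  have ab: "1 \<le> ?b" "?b < ?a" "?a \<le> n" using assms by auto
  have "min (min x y) z = min x z" if "z \<le> y" for x y z :: int
    using that by (simp add: min_def)
  then have 1: "sigma_word ?a ?b i = sigma_word a b i" if "i \<le> n" for i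
    using that by (simp add: sigma_word_def)
  have "tail_word ?b n = tail_word b n"
    by (simp add: tail_word_def)
  then have 2: "defect ?a ?b n = (defect a b n :: 'k wvec)"
    by (simp add: defect_def 1)
  have "(\<Sum>i\<in>{2..n - 1}. antipode_word (sigma_word ?a ?b i) \<squnion> \<eta> (i + 1) n) =
      (\<Sum>i\<in>{2..n - 1}. antipode_word (sigma_word a b i) \<squnion> (\<eta> (i + 1) n :: 'k wvec))"
    by (intro sum.cong) (auto simp: 1)
  then show ?thesis
    using antipode_sigma_word_rec_aux[OF ab, where 'k = 'k] by (simp add: 1 2)
qed

section \<open>Inverting the recursion\<close>

lemma eta_Cons: "k \<le> l \<Longrightarrow> \<eta> k l = word [k] \<cdot> \<eta> (k + 1) l"
  by (simp add: eta_def upto_rec1)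

lemma delta_Cons: "k \<le> l \<Longrightarrow> \<delta> l k = word [l] \<cdot> \<delta> (l - 1) k"
  by (simp add: delta_def upto_rec2)

lemma delta_snoc: "k \<le> l \<Longrightarrow> \<delta> l k = \<delta> l (k + 1) \<cdot> word [k]"
  by (simp add: delta_def upto_rec1)

lemma delta_empty [simp]: "\<delta> k (k + 1) = word []"
  by (simp add: delta_def)

lemma delta_zero: "l + 1 < k \<Longrightarrow> \<delta> l k = 0"
  by (simp add: delta_def)

lemma minus_one_powi_Suc: "(- 1 :: 'k::field) powi (i + 1) = - ((- 1) powi i)"
  by (simp add: power_int_add)

(* Splitting each shuffle by its first letter makes the alternating sum telescope. *)
lemma alternating_delta_eta_partial:
  assumes "k \<le> m" "m < n"
  shows "(\<Sum>i\<in>{k..m}. (- 1) powi (i + k) \<odot> (\<delta> i (k + 1) \<squnion> \<eta> (i + 1) n)) =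
    (- 1 :: 'k::field) powi (m + k) \<odot> (word [m + 1] \<cdot> (\<delta> m (k + 1) \<squnion> \<eta> (m + 2) n))"
  using assms
proof (induction m rule: int_ge_induct)
  case base
  then show ?case using eta_Cons[of "k + 1" n] by (simp add: add.assoc)
next
  case (step m)
  let ?G = "\<lambda>i. word [i + 1] \<cdot> (\<delta> i (k + 1) \<squnion> \<eta> (i + 2) n) :: 'k wvec"
  have "{k..m + 1} = insert (m + 1) {k..m}" using step by auto
  moreover have "\<delta> (m + 1) (k + 1) \<squnion> \<eta> (m + 2) n = ?G m + ?G (m + 1)"
    using step shuffle_letters_left[of "m + 1" "\<delta> m (k + 1)" "m + 2" "\<eta> (m + 3) n"]
    by (simp add: delta_Cons[of "k + 1" "m + 1"] eta_Cons[of "m + 2" n] add.assoc)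
  ultimately show ?case
    using step by (simp add: minus_one_powi_Suc[of "k + m", unfolded add.commute[of _ 1]]
        wvec.scale_right_distrib algebra_simps)
qed

text \<open>At \<open>m = n - 1\<close> the \<open>\<eta>\<close> factor of the boundary term is the
  empty word, and prefixing \<open>n\<close> to \<open>\<delta> (n - 1) (k + 1)\<close> gives
  \<open>\<delta> n (k + 1)\<close>.\<close>

lemma alternating_delta_eta:
  assumes "k < n"
  shows "(\<Sum>i\<in>{k..n - 1}. (- 1) powi (i + k) \<odot> (\<delta> i (k + 1) \<squnion> \<eta> (i + 1) n)) =
    - ((- 1 :: 'k::field) powi (n + k) \<odot> \<delta> n (k + 1))"
  using assms alternating_delta_eta_partial[of k "n - 1" n, where 'k = 'k]
    minus_one_powi_Suc[of "n - 1 + k", where 'k = 'k]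
  by (simp add: delta_Cons[of "1 + k" n] eta_def algebra_simps)

lemma antipode_sigma_word:
  assumes "1 \<le> b" "b < a" "2 \<le> n"
  shows "(antipode_word (sigma_word a b n) :: 'k::field wvec) =
    (\<Sum>k\<in>{2..n}. (- 1) powi (n + k) \<odot> (defect a b k \<squnion> \<delta> n (k + 1)))"
  using assms(3)
proof (induction "nat n" arbitrary: n rule: less_induct)
  case less
  let ?S = "\<lambda>i. antipode_word (sigma_word a b i) :: 'k wvec" and ?X = "\<lambda>k. defect a b k :: 'k wvec"
  let ?t = "\<lambda>i k. (- 1) powi (i + k) \<odot> (?X k \<squnion> (\<delta> i (k + 1) \<squnion> \<eta> (i + 1) n))"
  \<comment> \<open>The inner range 2 \<le> k \<le> i is written as a filter so that the double sum
    can be swapped.\<close>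
  have "?S i \<squnion> \<eta> (i + 1) n = (\<Sum>k\<in>{k \<in> {2..n - 1}. k \<le> i}. ?t i k)" if "i \<in> {2..n - 1}" for i
  proof -
    have "{k \<in> {2..n - 1}. k \<le> i} = {2..i}" using that by auto
    then show ?thesis
      using that less(1)[of i] by (simp add: shuffle_left_hom shuffle_assoc)
  qed
  then have "(\<Sum>i\<in>{2..n - 1}. ?S i \<squnion> \<eta> (i + 1) n) =
      (\<Sum>i\<in>{2..n - 1}. \<Sum>k\<in>{k \<in> {2..n - 1}. k \<le> i}. ?t i k)"
    by (intro sum.cong refl)
  also have "\<dots> = (\<Sum>k\<in>{2..n - 1}. \<Sum>i\<in>{i \<in> {2..n - 1}. k \<le> i}. ?t i k)"
    by (rule sum.swap_restrict) auto
  also have "\<dots> = (\<Sum>k\<in>{2..n - 1}. - ((- 1) powi (n + k) \<odot> (?X k \<squnion> \<delta> n (k + 1))))"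
  proof (intro sum.cong refl)
    fix k assume k: "k \<in> {2..n - 1}"
    then have "{i \<in> {2..n - 1}. k \<le> i} = {k..n - 1}" by auto
    then have "(\<Sum>i\<in>{i \<in> {2..n - 1}. k \<le> i}. ?t i k) =
        ?X k \<squnion> (\<Sum>i\<in>{k..n - 1}. (- 1) powi (i + k) \<odot> (\<delta> i (k + 1) \<squnion> \<eta> (i + 1) n))"
      by (simp add: shuffle_right_hom)
    also have "\<dots> = - ((- 1) powi (n + k) \<odot> (?X k \<squnion> \<delta> n (k + 1)))"
      using k by (simp add: alternating_delta_eta shuffle_right_hom)
    finally show "(\<Sum>i\<in>{i \<in> {2..n - 1}. k \<le> i}. ?t i k) =
        - ((- 1) powi (n + k) \<odot> (?X k \<squnion> \<delta> n (k + 1)))" .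
  qed
  finally have "?S n = ?X n + (\<Sum>k\<in>{2..n - 1}. (- 1) powi (n + k) \<odot> (?X k \<squnion> \<delta> n (k + 1)))"
    using antipode_sigma_word_rec[of b a n, where 'k = 'k] assms less(2) by (simp add: sum_negf)
  \<comment> \<open>The defect of the recursion is the summand \<open>k = n\<close>: there
    \<open>\<delta> n (n + 1)\<close> is the shuffle unit and the sign exponent is even.\<close>
  moreover have "{2..n} = insert n {2..n - 1}" using less(2) by auto
  ultimately show ?case by (simp add: power_int_minus_left)
qed

section \<open>Selecting a last letter\<close>

text \<open>\<open>S_star j\<close> without the antipode. Isolating it gives a derivation for the
  shuffle product, which can be applied to the inverted recursion term by term.\<close>

definition last_deriv :: "int \<Rightarrow> 'k::comm_ring_1 wvec \<Rightarrow> 'k wvec" where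
  "last_deriv j x = delete_last (last_part j x)"

lemma wlinear_last_deriv: "wlinear (last_deriv j)"
  unfolding last_deriv_def[abs_def] delete_last_def last_part_def
  by (rule wlinear_comp[OF wlinear_lin_ext wlinear_lin_ext])

lemmas last_deriv_hom = module_hom.zero[OF wlinear_last_deriv]
  module_hom.add[OF wlinear_last_deriv] module_hom.diff[OF wlinear_last_deriv]
  module_hom.scale[OF wlinear_last_deriv] module_hom.sum[OF wlinear_last_deriv]

lemma last_deriv_word:
  "last_deriv j (word w) = (if w \<noteq> [] \<and> last w = j then word (butlast w) else 0)"
  by (auto simp: last_deriv_def delete_last_def last_part_def
      module_hom.zero[OF wlinear_lin_ext])

lemma wlinear_if: "wlinear (\<lambda>x. if P then x else 0)"
  by (rule wlinearI) auto

lemma last_deriv_cat_letter: "last_deriv j (x \<cdot> word [c]) = (if c = j then x else 0)"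
  by (rule wlinear_eqI[where x = x];
      (intro wlinear_comp[OF wlinear_last_deriv] wlinear_intros wlinear_if)?;
      simp add: last_deriv_word)

text \<open>The last letter of a shuffle is the last letter of one of the two factors. An empty
  factor has derivative 0 and acts as the unit.\<close>

lemma last_deriv_shuffle_words:
  "last_deriv j (word u \<squnion> word v) = last_deriv j (word u) \<squnion> word v + word u \<squnion> last_deriv j (word v)"
proof (cases "u = [] \<or> v = []")
  case True
  then show ?thesis
    by (auto simp: last_deriv_word shuffle_left_hom shuffle_right_hom)
next
  case False
  then obtain u' c v' d where uv: "u = u' @ [c]" "v = v' @ [d]"
    by (metis rev_exhaust)
  show ?thesis
    unfolding uv
    by (simp add: shuffle_words_snoc last_deriv_hom last_deriv_cat_letter last_deriv_word
        shuffle_left_hom shuffle_right_hom)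
qed

lemma last_deriv_shuffle:
  "last_deriv j (x \<squnion> y) = last_deriv j x \<squnion> y + x \<squnion> last_deriv j y"
proof -
  note intros = wlinear_intros wlinear_comp[OF wlinear_last_deriv]
  have 1: "last_deriv j (word u \<squnion> y) = last_deriv j (word u) \<squnion> y + word u \<squnion> last_deriv j y" for u
    by (rule wlinear_eqI[where x = y]; (intro intros)?; rule last_deriv_shuffle_words)
  show ?thesis
    by (rule wlinear_eqI[where x = x]; (intro intros)?; rule 1)
qed

lemma last_deriv_delta:
  "last_deriv j (\<delta> n k) = (if k = j \<and> k \<le> n then \<delta> n (k + 1) else 0)"
proof -
  consider "k \<le> n" | "k = n + 1" | "n + 1 < k" by linarith
  then show ?thesis
    by cases (simp_all add: delta_snoc[of k n] last_deriv_cat_letter delta_zero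
        last_deriv_word last_deriv_hom)
qed

text \<open>The last letter is either \<open>c\<close> or the last letter \<open>q + 1\<close> of
  the decreasing word. The formula survives at \<open>q = n\<close>, because there
  \<open>\<delta> n (q + 1)\<close> is the unit and \<open>\<delta> n (q + 2)\<close> is the zero
  vector.\<close>

lemma snoc_shuffle_delta:
  assumes "q \<le> n"
  shows "(x \<cdot> word [c]) \<squnion> \<delta> n (q + 1) =
    (x \<squnion> \<delta> n (q + 1)) \<cdot> word [c] + ((x \<cdot> word [c]) \<squnion> \<delta> n (q + 2)) \<cdot> word [q + 1]"
proof (cases "q = n")
  case True
  then show ?thesis by (simp add: delta_zero shuffle_right_hom cat_hom)
next
  case False
  then show ?thesis
    using assms shuffle_letters_right[of x c "\<delta> n (q + 2)" "q + 1"]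
    by (simp add: delta_snoc[of "q + 1" n] add.assoc)
qed

(* The same telescoping, now by last letters. *)
lemma alternating_snoc_delta_partial:
  assumes "m \<le> p" "p \<le> n"
  shows "(\<Sum>i\<in>{m..p}. (- 1) powi i \<odot> (word (w @ [c] @ [m + 1..i]) \<squnion> \<delta> n (i + 1))) =
    (- 1 :: 'k::field) powi m \<odot> ((word w \<squnion> \<delta> n (m + 1)) \<cdot> word [c])
    + (- 1) powi p \<odot> ((word (w @ [c] @ [m + 1..p]) \<squnion> \<delta> n (p + 2)) \<cdot> word [p + 1])"
  using assms
proof (induction p rule: int_ge_induct)
  case base
  then show ?case
    using snoc_shuffle_delta[of m n "word w :: 'k wvec" c]
    by (simp add: wvec.scale_right_distrib)
next
  case (step p)
  have "{m..p + 1} = insert (p + 1) {m..p}" using step by auto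
  moreover have "[m + 1..p + 1] = [m + 1..p] @ [p + 1]"
    using step upto_rec2[of "m + 1" "p + 1"] by simp
  ultimately show ?case
    using step snoc_shuffle_delta[of "p + 1" n "word (w @ [c] @ [m + 1..p]) :: 'k wvec" "p + 1"]
    by (simp add: minus_one_powi_Suc[of p, unfolded add.commute[of _ 1]]
        wvec.scale_right_distrib algebra_simps)
qed

text \<open>At \<open>p = n\<close> the upper boundary term contains
  \<open>\<delta> n (n + 2)\<close>, which is 0. For \<open>m = n + 1\<close> both sides
  vanish.\<close>

lemma alternating_snoc_delta:
  assumes "m \<le> n + 1"
  shows "(\<Sum>i\<in>{m..n}. (- 1) powi i \<odot> (word (w @ [c] @ [m + 1..i]) \<squnion> \<delta> n (i + 1))) =
    (- 1 :: 'k::field) powi m \<odot> ((word w \<squnion> \<delta> n (m + 1)) \<cdot> word [c])"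
proof (cases "m = n + 1")
  case True
  then show ?thesis by (simp add: delta_zero shuffle_right_hom cat_hom)
next
  case False
  then show ?thesis
    using assms alternating_snoc_delta_partial[of m n n w c, where 'k = 'k]
    by (simp add: delta_zero shuffle_right_hom cat_hom)
qed

section \<open>Closed forms of the words according to the position of \<open>k\<close> relative to
  \<open>b\<close> and \<open>a\<close>\<close>

lemma tail_word_small: "2 \<le> k \<Longrightarrow> k \<le> b + 1 \<Longrightarrow> tail_word b k = k # [2..k - 1]"
  by (simp add: tail_word_def Let_def)

lemma tail_word_large: "b + 1 \<le> k \<Longrightarrow> tail_word b k = (b + 1) # [2..b] @ [b + 2..k]"
  by (simp add: tail_word_def Let_def)

lemma sigma_word_small:
  "b < a \<Longrightarrow> 2 \<le> k \<Longrightarrow> k \<le> b + 1 \<Longrightarrow> sigma_word a b k = [k, k - 1] @ [1..k - 2]"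
  by (simp add: sigma_word_def Let_def)

lemma sigma_word_middle:
  "b + 1 \<le> k \<Longrightarrow> k \<le> a \<Longrightarrow> sigma_word a b k = [k, b] @ [1..b - 1] @ [b + 1..k - 1]"
  by (simp add: sigma_word_def Let_def)

lemma sigma_word_large:
  "b < a \<Longrightarrow> a \<le> k \<Longrightarrow>
    sigma_word a b k = [a, b] @ [1..b - 1] @ [b + 1..a - 1] @ [a + 1..k]"
  by (simp add: sigma_word_def Let_def)

lemma sigma_A_eq: "1 \<le> b \<Longrightarrow> b < a \<Longrightarrow> a \<le> n \<Longrightarrow> sigma_A a b n = word (sigma_word a b n)"
  by (simp add: sigma_A_word sigma_word_large)

lemma last_deriv_snoc: "v = w @ [c] \<Longrightarrow> last_deriv j (word v) = (if j = c then word w else 0)"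
  by (simp add: last_deriv_word)

text \<open>Product rule for the inverted recursion. The factor \<open>\<delta> n (k + 1)\<close>
  ends in \<open>k + 1\<close>, so its derivative survives only for \<open>k = j - 1\<close>; as
  \<open>k\<close> starts at 2, this needs 3 \<le> j.\<close>

lemma S_star_sigma:
  assumes "1 \<le> b" "b < a" "a \<le> n" "1 \<le> j" "j \<le> n"
  shows "S_star j (sigma_A a b n :: 'k::field wvec) =
    (\<Sum>k\<in>{2..n}. (- 1) powi (n + k) \<odot> (last_deriv j (defect a b k) \<squnion> \<delta> n (k + 1)))
    + (if 3 \<le> j then (- 1) powi (n + j + 1) \<odot> (defect a b (j - 1) \<squnion> \<delta> n (j + 1)) else 0)"
proof -
  let ?f = "\<lambda>k. (- 1) powi (n + k) \<odot> (last_deriv j (defect a b k) \<squnion> \<delta> n (k + 1)) :: 'k wvec"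
  let ?g = "\<lambda>k. (- 1) powi (n + k) \<odot> (defect a b k \<squnion> \<delta> n (k + 2)) :: 'k wvec"
  have "S_star j (sigma_A a b n) = last_deriv j (antipode_word (sigma_word a b n) :: 'k wvec)"
    using assms by (simp add: S_star_def last_deriv_def sigma_A_eq)
  also have "\<dots> = (\<Sum>k\<in>{2..n}. ?f k + (if k = j - 1 then ?g k else 0))"
    using assms by (subst antipode_sigma_word)
      (auto simp: last_deriv_hom last_deriv_shuffle last_deriv_delta
        shuffle_right_hom wvec.scale_right_distrib add.commute intro!: sum.cong)
  also have "\<dots> = (\<Sum>k\<in>{2..n}. ?f k) + (if j - 1 \<in> {2..n} then ?g (j - 1) else 0)"
    by (simp add: sum.distrib)
  also have "(- 1 :: 'k) powi (n + (j - 1)) = (- 1) powi (n + j + 1)"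
    using minus_one_powi_Suc[of "n + (j - 1)", where 'k = 'k]
      minus_one_powi_Suc[of "n + j", where 'k = 'k] by simp
  finally show ?thesis
    using assms by (auto simp: add.commute)
qed

lemma last_deriv_defect:
  "last_deriv j (defect a b k) =
    (if j = 1 then word (tail_word b k) else 0) + word [1] \<squnion> last_deriv j (word (tail_word b k))
    - last_deriv j (word (sigma_word a b k))"
  by (simp add: defect_def last_deriv_hom last_deriv_shuffle last_deriv_word[of j "[1]"]
      shuffle_left_hom del: shuffle_word)

text \<open>The length \<open>k = 2\<close> is left out: there the tail is the single letter 2,
  which ends in \<open>k\<close> and not in \<open>k - 1\<close>.\<close>

lemma last_deriv_tail_word_small:
  assumes "3 \<le> k" "k \<le> b + 1"
  shows "last_deriv j (word (tail_word b k)) = (if j = k - 1 then word (k # [2..k - 2]) else 0)"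
  using assms
  by (intro last_deriv_snoc) (simp add: tail_word_small upto_rec2[of 2 "k - 1"])

lemma last_deriv_tail_word_large:
  assumes "b + 2 \<le> k"
  shows "last_deriv j (word (tail_word b k)) = (if j = k then word (tail_word b (k - 1)) else 0)"
  using assms
  by (intro last_deriv_snoc) (simp add: tail_word_large upto_rec2[of "b + 2" k])

lemma last_deriv_sigma_word_small:
  assumes "b < a" "3 \<le> k" "k \<le> b + 1"
  shows "last_deriv j (word (sigma_word a b k)) =
    (if j = k - 2 then word ([k, k - 1] @ [1..k - 3]) else 0)"
  using assms
  by (intro last_deriv_snoc) (simp add: sigma_word_small upto_rec2[of 1 "k - 2"])

lemma last_deriv_sigma_word_middle:
  assumes "b + 2 \<le> k" "k \<le> a"
  shows "last_deriv j (word (sigma_word a b k)) =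
    (if j = k - 1 then word ([k, b] @ [1..b - 1] @ [b + 1..k - 2]) else 0)"
  using assms
  by (intro last_deriv_snoc) (simp add: sigma_word_middle upto_rec2[of "b + 1" "k - 1"])

lemma last_deriv_sigma_word_large:
  assumes "b < a" "a < k"
  shows "last_deriv j (word (sigma_word a b k)) =
    (if j = k then word (sigma_word a b (k - 1)) else 0)"
  using assms
  by (intro last_deriv_snoc) (simp add: sigma_word_large upto_rec2[of "a + 1" k])

text \<open>The shuffle of 1 and 2 is 12 + 21, and subtracting 21 leaves the single word 12.\<close>

lemma last_deriv_defect_2:
  assumes "1 \<le> b" "b < a" "1 \<le> j"
  shows "last_deriv j (defect a b 2) = (if j = 2 then word [1] else 0)"
  using assms
  by (simp add: last_deriv_defect tail_word_small sigma_word_small last_deriv_word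
      shuffle_right_hom del: shuffle_word)

lemma last_deriv_defect_small:
  assumes "b < a" "3 \<le> k" "k \<le> b + 1" "2 \<le> j"
  shows "last_deriv j (defect a b k) =
    (if k = j + 1 then word [1] \<squnion> word ((j + 1) # [2..j - 1])
     else if k = j + 2 then - word ([j + 2, j + 1] @ [1..j - 1]) else 0)"
  using assms
  by (auto simp: last_deriv_defect last_deriv_tail_word_small last_deriv_sigma_word_small
      shuffle_right_hom add.commute simp del: shuffle_word)

lemma last_deriv_defect_middle:
  assumes "b + 2 \<le> k" "k \<le> a" "2 \<le> j"
  shows "last_deriv j (defect a b k) =
    (if k = j then word [1] \<squnion> word (tail_word b (j - 1))
     else if k = j + 1 then - word ([j + 1, b] @ [1..b - 1] @ [b + 1..j - 1]) else 0)"
  using assms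
  by (auto simp: last_deriv_defect last_deriv_tail_word_large last_deriv_sigma_word_middle
      shuffle_right_hom simp del: shuffle_word)

text \<open>Beyond \<open>a\<close> both the tail and the prefix word end in \<open>k\<close>, and
  deleting it gives the words of length one less. This cancels the correction term in
  \<open>S_star_sigma_ge_2\<close> when j > a.\<close>

lemma last_deriv_defect_large:
  assumes "b < a" "a < k" "2 \<le> j"
  shows "last_deriv j (defect a b k) = (if k = j then defect a b (j - 1) else 0)"
  using assms
  by (auto simp: last_deriv_defect last_deriv_tail_word_large last_deriv_sigma_word_large
      shuffle_right_hom simp del: shuffle_word)
    (simp_all add: defect_def)

text \<open>For \<open>j = 1\<close> the derivation removes the shuffled letter 1 itself and leaves
  the tail. The exceptions are the prefix words 21 and 321, which also end in 1 and cancel the tails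
  2 and 32.\<close>

lemma last_deriv_defect_1:
  assumes "1 \<le> b" "b < a" "2 \<le> k"
  shows "last_deriv 1 (defect a b k) =
    (if k = 2 \<or> k = 3 \<and> 2 \<le> b then 0 else word (tail_word b k))"
proof -
  have 2: "tail_word b 2 = [2]" "sigma_word a b 2 = [2, 1]"
    using assms by (simp_all add: tail_word_small sigma_word_small)
  have 3: "tail_word b 3 = [3, 2]" if "2 \<le> b"
    using that by (simp add: tail_word_small)
  have l: "last_deriv 1 (word [2]) = 0" "last_deriv 1 (word [3, 2]) = 0"
    "last_deriv 1 (word [2, 1]) = word [2]"
    by (simp_all add: last_deriv_word)
  consider "k = 2" | "3 \<le> k" "k \<le> b + 1" | "b + 2 \<le> k" "k \<le> a" | "b + 2 \<le> k" "a < k"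
    using assms by linarith
  then show ?thesis
    using assms
    by cases (auto simp: last_deriv_defect last_deriv_tail_word_small last_deriv_tail_word_large
        last_deriv_sigma_word_small last_deriv_sigma_word_middle last_deriv_sigma_word_large
        2 3 l shuffle_right_hom simp del: shuffle_word)
qed

text \<open>For j \<ge> 2 the words that contribute to the derivative of the defect at
  \<open>k\<close> end in \<open>k\<close>, \<open>k - 1\<close> or \<open>k - 2\<close>, so only
  three summands remain.\<close>

lemma S_star_sigma_ge_2:
  assumes "1 \<le> b" "b < a" "a \<le> n" "2 \<le> j" "j \<le> n"
  shows "S_star j (sigma_A a b n :: 'k::field wvec) = (- 1) powi (n + j) \<odot>
    (last_deriv j (defect a b j) \<squnion> \<delta> n (j + 1)
     - last_deriv j (defect a b (j + 1)) \<squnion> \<delta> n (j + 2)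
     + last_deriv j (defect a b (j + 2)) \<squnion> \<delta> n (j + 3)
     - (if 3 \<le> j then defect a b (j - 1) \<squnion> \<delta> n (j + 1) else 0))"
proof -
  let ?f = "\<lambda>k. (- 1) powi (n + k) \<odot> (last_deriv j (defect a b k) \<squnion> \<delta> n (k + 1)) :: 'k wvec"
  have zero: "?f k = 0" if "k \<in> {2..n} - {j, j + 1, j + 2}" for k
  proof -
    have k: "2 \<le> k" using that by simp
    consider "k = 2" | "3 \<le> k" "k \<le> b + 1" | "b + 2 \<le> k" "k \<le> a" | "b + 2 \<le> k" "a < k"
      using k assms by linarith
    then have "last_deriv j (defect a b k :: 'k wvec) = 0"
      using that assms
      by cases (simp_all add: last_deriv_defect_2 last_deriv_defect_small
          last_deriv_defect_middle last_deriv_defect_large)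
    then show ?thesis by (simp add: shuffle_left_hom)
  qed
  \<comment> \<open>The indices \<open>j + 1\<close> and \<open>j + 2\<close> may exceed
    \<open>n\<close>; adding them is harmless, since \<open>\<delta> n (k + 1)\<close> is 0 for k >
    n.\<close>
  have "(\<Sum>k\<in>{2..n}. ?f k) = (\<Sum>k\<in>{2..n} \<union> {j, j + 1, j + 2}. ?f k)"
    by (rule sum.mono_neutral_left) (use assms in \<open>auto simp: delta_zero shuffle_right_hom\<close>)
  also have "\<dots> = (\<Sum>k\<in>{j, j + 1, j + 2}. ?f k)"
    by (rule sum.mono_neutral_right) (use zero in auto)
  also have "\<dots> = ?f j + ?f (j + 1) + ?f (j + 2)"
    by (simp add: add.assoc)
  finally have sum: "(\<Sum>k\<in>{2..n}. ?f k) = ?f j + ?f (j + 1) + ?f (j + 2)" .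
  have sign: "(- 1 :: 'k) powi (n + j + 1) = - ((- 1) powi (n + j))"
    "(- 1 :: 'k) powi (n + (j + 1)) = - ((- 1) powi (n + j))"
    "(- 1 :: 'k) powi (n + (j + 2)) = (- 1) powi (n + j)"
    using minus_one_powi_Suc[of "n + j", where 'k = 'k]
      minus_one_powi_Suc[of "n + j + 1", where 'k = 'k] by (simp_all add: add.assoc)
  have "j + 1 + 1 = j + 2" "j + 2 + 1 = j + 3" by simp_all
  then show ?thesis
    using assms
    by (subst S_star_sigma) (simp_all only: sum sign,
        simp_all add: wvec.scale_right_distrib wvec.scale_right_diff_distrib)
qed

section \<open>Evaluation by cases\<close>

lemma S_star_sigma_1:
  assumes "1 \<le> b" "b < a" "a \<le> n"
  shows "S_star 1 (sigma_A a b n :: 'k::field wvec) = (- 1) powi n \<odot>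
    (\<Sum>k\<in>{if b = 1 then 3 else 4..n}. (- 1) powi k \<odot> (word (tail_word b k) \<squnion> \<delta> n (k + 1)))"
proof -
  have "S_star 1 (sigma_A a b n :: 'k wvec) =
      (\<Sum>k\<in>{2..n}. (- 1) powi (n + k) \<odot> (last_deriv 1 (defect a b k) \<squnion> \<delta> n (k + 1)))"
    using assms by (subst S_star_sigma) simp_all
  also have "\<dots> = (\<Sum>k\<in>{if b = 1 then 3 else 4..n}.
      (- 1) powi (n + k) \<odot> (word (tail_word b k) \<squnion> \<delta> n (k + 1)))"
    using assms
    by (intro sum.mono_neutral_cong_right)
      (auto simp: last_deriv_defect_1 shuffle_left_hom split: if_splits)
  finally show ?thesis
    by (simp add: power_int_add wvec.scale_sum_right)
qed

text \<open>From length \<open>m\<close> on the tail words differ only by a growing increasing end,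
  so the alternating sum telescopes to its lower boundary.\<close>

lemma alternating_tail_word_delta:
  assumes "m \<le> n + 1" "\<And>k. m \<le> k \<Longrightarrow> tail_word b k = w @ [c] @ [m + 1..k]"
  shows "(\<Sum>k\<in>{m..n}. (- 1) powi k \<odot> (word (tail_word b k) \<squnion> \<delta> n (k + 1))) =
    (- 1 :: 'k::field) powi m \<odot> ((word w \<squnion> \<delta> n (m + 1)) \<cdot> word [c])"
  unfolding alternating_snoc_delta[OF assms(1), symmetric]
  using assms(2) by (intro sum.cong) auto

lemma S_star_sigma_1_b_1:
  assumes "1 < a" "a \<le> n"
  shows "S_star 1 (sigma_A a 1 n :: 'k::field wvec) =
    (- 1) powi (n + 1) \<odot> ((word [2] \<squnion> \<delta> n 4) \<cdot> word [3])"
proof -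
  have t: "tail_word 1 k = [2] @ [3] @ [3 + 1..k]" if "3 \<le> k" for k
    using that by (simp add: tail_word_large upto_rec1)
  show ?thesis
    using assms by (simp add: S_star_sigma_1 alternating_tail_word_delta[OF _ t] power_int_add)
qed

lemma S_star_sigma_1_b_2:
  assumes "2 < a" "a \<le> n"
  shows "S_star 1 (sigma_A a 2 n :: 'k::field wvec) =
    (- 1) powi n \<odot> ((word [3, 2] \<squnion> \<delta> n 5) \<cdot> word [4])"
proof -
  have t: "tail_word 2 k = [3, 2] @ [4] @ [4 + 1..k]" if "4 \<le> k" for k
    using that by (simp add: tail_word_large upto_rec1)
  show ?thesis
    using assms by (simp add: S_star_sigma_1 alternating_tail_word_delta[OF _ t])
qed

lemma S_star_sigma_1_b_ge_3:
  assumes "3 \<le> b" "b < a" "a \<le> n"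
  shows "S_star 1 (sigma_A a b n :: 'k::field wvec) =
    (- 1) powi (n + b + 1) \<odot> ((word [b + 1] \<cdot> \<eta> 2 (b - 1) \<squnion> \<delta> n (b + 2)) \<cdot> word [b])
    + (\<Sum>k=4..b. (- 1) powi (n + k) \<odot> (word [k] \<cdot> \<eta> 2 (k - 1) \<squnion> \<delta> n (k + 1)))"
proof -
  let ?t = "\<lambda>k. (- 1) powi k \<odot> (word (tail_word b k) \<squnion> \<delta> n (k + 1)) :: 'k wvec"
  let ?w = "(b + 1) # [2..b - 1]"
  \<comment> \<open>Up to \<open>k = b\<close> the tail starts with the varying letter
    \<open>k\<close>, and these terms stay as they are. From \<open>b + 1\<close> on its first
    letter is fixed at \<open>b + 1\<close> and the sum telescopes.\<close>
  have "{4..n} = {4..b} \<union> {b + 1..n}" using assms by auto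
  then have split: "(\<Sum>k\<in>{4..n}. ?t k) = (\<Sum>k\<in>{4..b}. ?t k) + (\<Sum>k\<in>{b + 1..n}. ?t k)"
    by (simp add: sum.union_disjoint)
  have "(\<Sum>k\<in>{4..b}. ?t k) =
      (\<Sum>k\<in>{4..b}. (- 1) powi k \<odot> (word [k] \<cdot> \<eta> 2 (k - 1) \<squnion> \<delta> n (k + 1)))"
    by (intro sum.cong) (auto simp: tail_word_small eta_def)
  moreover have t: "tail_word b k = ?w @ [b] @ [b + 1 + 1..k]" if "b + 1 \<le> k" for k
    using that assms by (simp add: tail_word_large upto_rec2[of 2 b] add.assoc)
  have "(\<Sum>k\<in>{b + 1..n}. ?t k) = (- 1) powi (b + 1) \<odot>
      ((word [b + 1] \<cdot> \<eta> 2 (b - 1) \<squnion> \<delta> n (b + 2)) \<cdot> word [b])"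
    using assms by (subst alternating_tail_word_delta[OF _ t]) (simp_all add: eta_def add.assoc)
  ultimately show ?thesis
    using assms split S_star_sigma_1[of b a n, where 'k = 'k]
    by (simp add: power_int_add wvec.scale_right_distrib wvec.scale_right_diff_distrib
        wvec.scale_sum_right mult.commute)
qed

lemmas last_deriv_defect_ge_2 = last_deriv_defect_2 last_deriv_defect_small
  last_deriv_defect_middle last_deriv_defect_large

lemmas wvec_hom = shuffle_left_hom shuffle_right_hom cat_hom
  wvec.scale_right_distrib wvec.scale_right_diff_distrib

section \<open>Last letter 2\<close>

lemma S_star_sigma_2_b_1:
  assumes "1 < a" "a \<le> n"
  shows "S_star 2 (sigma_A a 1 n :: 'k::field wvec) = (- 1) powi n \<odot>
    (if a = 2 then word [1] \<squnion> \<delta> n 3 else word [1] \<squnion> \<delta> n 3 + word [3, 1] \<squnion> \<delta> n 4)"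
  using assms
  \<comment> \<open>The value of \<open>a\<close> decides whether the defects at 3 and 4 count as
    middle or large.\<close>
  by (cases "a = 2"; cases "a = 3")
    (simp_all add: S_star_sigma_ge_2 last_deriv_defect_ge_2 wvec_hom power_int_add
      del: shuffle_word)

lemma S_star_sigma_2_b_ge_2:
  assumes "2 \<le> b" "b < a" "a \<le> n"
  shows "S_star 2 (sigma_A a b n :: 'k::field wvec) = (- 1) powi (n + 1) \<odot>
    (word [1] \<squnion> (word [3] \<squnion> \<delta> n 5) \<cdot> word [4]
     + (if b = 2 then 0 else word [4, 3, 1] \<squnion> \<delta> n 5))"
proof -
  \<comment> \<open>Of the two last-letter parts of 3 shuffled with \<open>\<delta> n 4\<close>, the
    one ending in 3 is \<open>\<delta> n 3\<close>. It cancels the summand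
    \<open>word [1] \<squnion> \<delta> n 3\<close> coming from \<open>k = 2\<close>.\<close>
  have "word [1] \<squnion> word [3] \<squnion> \<delta> n 4 =
      word [1] \<squnion> ((\<delta> n 4 \<cdot> word [3]) + (word [3] \<squnion> \<delta> n 5) \<cdot> (word [4] :: 'k wvec))"
    using snoc_shuffle_delta[of 3 n "word [] :: 'k wvec" 3] assms by (simp add: shuffle_assoc del: shuffle_word)
  also have "\<delta> n 4 \<cdot> word [3] = (\<delta> n 3 :: 'k wvec)"
    using assms by (simp add: delta_snoc[of 3 n])
  finally have split: "word [1] \<squnion> word [3] \<squnion> \<delta> n 4 =
      word [1] \<squnion> \<delta> n 3 + word [1] \<squnion> (word [3] \<squnion> \<delta> n 5) \<cdot> (word [4] :: 'k wvec)"
    by (simp add: wvec_hom)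
  show ?thesis
    using assms split
    by (cases "b = 2"; cases "a = b + 1")
      (simp_all add: S_star_sigma_ge_2 last_deriv_defect_ge_2 wvec_hom power_int_add
        del: shuffle_word)
qed

section \<open>Last letter at least 3\<close>

lemma defect_small:
  assumes "1 \<le> b" "b < a" "3 \<le> j" "j \<le> b + 2"
  shows "defect a b (j - 1) =
    word [1] \<squnion> word [j - 1] \<cdot> \<eta> 2 (j - 2) - \<delta> (j - 1) (j - 2) \<cdot> \<eta> 1 (j - 3)"
  using assms
  by (simp add: defect_def tail_word_small sigma_word_small eta_def delta_def
      upto_rec1[of "j - 2"] upto_rec1[of "j - 1"] del: shuffle_word)

lemma last_deriv_defect_ge_b:
  assumes "b < a" "2 \<le> j" "b \<le> j"
  shows "last_deriv j (defect a b (j + 2)) = 0"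
  using assms
  by (cases "j + 2 \<le> a") (simp_all add: last_deriv_defect_middle last_deriv_defect_large)

lemma S_star_sigma_ge_3:
  assumes "1 \<le> b" "b < a" "a \<le> n" "3 \<le> j" "j \<le> b + 1"
  shows "S_star j (sigma_A a b n :: 'k::field wvec) = (- 1) powi (n + j + 1) \<odot>
    ((word [1] \<squnion> word [j - 1] \<cdot> \<eta> 2 (j - 2) - \<delta> (j - 1) (j - 2) \<cdot> \<eta> 1 (j - 3)) \<squnion> \<delta> n (j + 1)
     + (if j \<le> b then word [1] \<squnion> word [j + 1] \<cdot> \<eta> 2 (j - 1) \<squnion> \<delta> n (j + 2)
        else if a = b + 1 then 0
        else - (word [j + 1, j - 1] \<cdot> \<eta> 1 (j - 2) \<squnion> \<delta> n (j + 2)))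
     + (if j \<le> b - 1 then \<delta> (j + 2) (j + 1) \<cdot> \<eta> 1 (j - 1) \<squnion> \<delta> n (j + 3) else 0))"
proof -
  have sign: "(- 1 :: 'k) powi (n + j + 1) = - ((- 1) powi (n + j))"
    by (rule minus_one_powi_Suc)
  have d: "\<delta> (j + 2) (j + 1) = (word [j + 2, j + 1] :: 'k wvec)"
    by (simp add: delta_def upto_rec1[of "j + 1" "j + 2"] add.assoc)
  have e: "\<eta> 2 (j - 1) = (word [2..j - 1] :: 'k wvec)" "\<eta> 1 (j - 1) = (word [1..j - 1] :: 'k wvec)"
    "\<eta> 1 (j - 2) = (word [1..j - 2] :: 'k wvec)"
    using assms by (simp_all add: eta_def)
  have x: "defect a b (j - 1) = (word [1] \<squnion> word [j - 1] \<cdot> \<eta> 2 (j - 2) -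
      \<delta> (j - 1) (j - 2) \<cdot> \<eta> 1 (j - 3) :: 'k wvec)"
    using assms by (intro defect_small) auto
  have d2: "last_deriv j (defect a b (j + 2)) =
      (if j \<le> b - 1 then - word ([j + 2, j + 1] @ [1..j - 1]) else 0 :: 'k wvec)"
    using assms last_deriv_defect_ge_b[of b a j] by (auto simp: last_deriv_defect_small)
  have star: "S_star j (sigma_A a b n :: 'k wvec) = (- 1) powi (n + j) \<odot>
      (last_deriv j (defect a b j) \<squnion> \<delta> n (j + 1)
       - last_deriv j (defect a b (j + 1)) \<squnion> \<delta> n (j + 2)
       + last_deriv j (defect a b (j + 2)) \<squnion> \<delta> n (j + 3)
       - defect a b (j - 1) \<squnion> \<delta> n (j + 1))"
    using assms by (simp add: S_star_sigma_ge_2)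
  \<comment> \<open>The boundaries record when \<open>j + 2\<close> and then \<open>j + 1\<close>
    leave the range up to \<open>b + 1\<close>. For \<open>j = b + 1\<close> the defect at
    \<open>j + 1 = b + 2\<close> is middle or large depending on \<open>a\<close>.\<close>
  consider "j \<le> b - 1" | "j = b" | "j = b + 1" "a = b + 1" | "j = b + 1" "b + 2 \<le> a"
    using assms by linarith
  then show ?thesis
    unfolding x[symmetric] sign d e star d2
    using assms
    by cases (auto simp: last_deriv_defect_ge_2 wvec_hom simp del: shuffle_word)
qed

text \<open>For j \<le> a the derivative at \<open>k = j\<close> and the subtracted
  \<open>defect a b (j - 1)\<close> share the shuffle of 1 with a tail, so their difference is the
  prefix word of length \<open>j - 1\<close>. For j > a they cancel completely.\<close>

lemma S_star_sigma_ge_b_2: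
  assumes "1 \<le> b" "b < a" "a \<le> n" "b + 2 \<le> j" "j \<le> n"
  shows "S_star j (sigma_A a b n :: 'k::field wvec) = (- 1) powi (n + j) \<odot>
    ((if j \<le> a then word [j - 1, b] \<cdot> \<eta> 1 (b - 1) \<cdot> \<eta> (b + 1) (j - 2) \<squnion> \<delta> n (j + 1) else 0)
     + (if j < a then word [j + 1, b] \<cdot> \<eta> 1 (b - 1) \<cdot> \<eta> (b + 1) (j - 1) \<squnion> \<delta> n (j + 2) else 0))"
proof -
  have e: "\<eta> 1 (b - 1) = (word [1..b - 1] :: 'k wvec)"
    "\<eta> (b + 1) (j - 1) = (word [b + 1..j - 1] :: 'k wvec)"
    "\<eta> (b + 1) (j - 2) = (word [b + 1..j - 2] :: 'k wvec)"
    using assms by (simp_all add: eta_def)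
  have x: "defect a b (j - 1) = (word [1] \<squnion> word (tail_word b (j - 1)) -
      word ([j - 1, b] @ [1..b - 1] @ [b + 1..j - 2]) :: 'k wvec)" if "j \<le> a"
    using that assms by (simp add: defect_def sigma_word_middle)
  have d0: "last_deriv j (defect a b j) = (if j \<le> a then word [1] \<squnion> word (tail_word b (j - 1))
      else defect a b (j - 1) :: 'k wvec)"
    using assms by (auto simp: last_deriv_defect_middle last_deriv_defect_large)
  have d1: "last_deriv j (defect a b (j + 1)) =
      (if j < a then - word ([j + 1, b] @ [1..b - 1] @ [b + 1..j - 1]) else 0 :: 'k wvec)"
    using assms by (auto simp: last_deriv_defect_middle last_deriv_defect_large)
  have d2: "last_deriv j (defect a b (j + 2)) = (0 :: 'k wvec)"
    using assms by (simp add: last_deriv_defect_ge_b)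
  have "S_star j (sigma_A a b n :: 'k wvec) = (- 1) powi (n + j) \<odot>
      (last_deriv j (defect a b j) \<squnion> \<delta> n (j + 1)
       - last_deriv j (defect a b (j + 1)) \<squnion> \<delta> n (j + 2)
       + last_deriv j (defect a b (j + 2)) \<squnion> \<delta> n (j + 3)
       - defect a b (j - 1) \<squnion> \<delta> n (j + 1))"
    using assms by (simp add: S_star_sigma_ge_2)
  then show ?thesis
    unfolding e d0 d1 d2 by (cases "j \<le> a") (simp_all add: x wvec_hom del: shuffle_word)
qed

text \<open>For j = 1 only tail words enter, and these do not involve \<open>a\<close>. For 2 \<le>
  j \<le> b the evaluated formulas never reach a branch that tests \<open>a\<close>.\<close>

lemma S_star_sigma_independent:
  assumes "1 \<le> j" "j \<le> b" "b < a" "a \<le> n" "b < a'" "a' \<le> n"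
  shows "S_star j (sigma_A a' b n :: 'k::field wvec) = S_star j (sigma_A a b n)"
proof -
  consider "j = 1" | "j = 2" | "3 \<le> j" using assms by linarith
  then show ?thesis
    using assms
    by cases (simp_all add: S_star_sigma_1 S_star_sigma_2_b_ge_2 S_star_sigma_ge_3 del: shuffle_word)
qed

theorem theorem2p3:
  fixes a b n j :: int
    and \<sigma> :: "'k::field_char_0 wvec"
  assumes ab: "1 \<le> b" "b < a" "a \<le> n"
    and j: "1 \<le> j" "j \<le> n"
    and \<sigma>: "\<sigma> = sigma_A a b n"
  shows
    "(j = 1 \<and> b = 1 \<longrightarrow>
        S_star j \<sigma> = (-1) powi (n + 1) \<odot> ((word [2] \<squnion> \<delta> n 4) \<cdot> word [3])) \<and>
     (j = 1 \<and> b = 2 \<longrightarrow>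
        S_star j \<sigma> = (-1) powi n \<odot> ((word [3, 2] \<squnion> \<delta> n 5) \<cdot> word [4])) \<and>
     (j = 1 \<and> b \<ge> 3 \<longrightarrow>
        S_star j \<sigma> =
          (-1) powi (n + b + 1) \<odot> ((word [b + 1] \<cdot> \<eta> 2 (b - 1) \<squnion> \<delta> n (b + 2)) \<cdot> word [b])
          + (\<Sum>k=4..b. (-1) powi (n + k) \<odot> (word [k] \<cdot> \<eta> 2 (k - 1) \<squnion> \<delta> n (k + 1)))) \<and>
     (j = 2 \<and> b = 1 \<and> a = 2 \<longrightarrow>
        S_star j \<sigma> = (-1) powi n \<odot> (word [1] \<squnion> \<delta> n 3)) \<and>
     (j = 2 \<and> b = 1 \<and> a \<ge> 3 \<longrightarrow>
        S_star j \<sigma> = (-1) powi n \<odot> (word [1] \<squnion> \<delta> n 3 + word [3, 1] \<squnion> \<delta> n 4)) \<and>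
     (j = 2 \<and> b = 2 \<longrightarrow>
        S_star j \<sigma> =
          (-1) powi (n + 1) \<odot> (word [1] \<squnion> (word [3] \<squnion> \<delta> n 5) \<cdot> word [4])) \<and>
     (j = 2 \<and> b \<ge> 3 \<longrightarrow>
        S_star j \<sigma> =
          (-1) powi (n + 1) \<odot> (word [1] \<squnion> (word [3] \<squnion> \<delta> n 5) \<cdot> word [4]
                               + word [4, 3, 1] \<squnion> \<delta> n 5)) \<and>
     (3 \<le> j \<and> j \<le> b - 1 \<longrightarrow>
        S_star j \<sigma> =
          (-1) powi (n + j + 1) \<odot>
            ((word [1] \<squnion> word [j - 1] \<cdot> \<eta> 2 (j - 2) - \<delta> (j - 1) (j - 2) \<cdot> \<eta> 1 (j - 3)) \<squnion> \<delta> n (j + 1)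
             + word [1] \<squnion> word [j + 1] \<cdot> \<eta> 2 (j - 1) \<squnion> \<delta> n (j + 2)
             + \<delta> (j + 2) (j + 1) \<cdot> \<eta> 1 (j - 1) \<squnion> \<delta> n (j + 3))) \<and>
     (3 \<le> j \<and> j = b \<longrightarrow>
        S_star j \<sigma> =
          (-1) powi (n + j + 1) \<odot>
            ((word [1] \<squnion> word [j - 1] \<cdot> \<eta> 2 (j - 2) - \<delta> (j - 1) (j - 2) \<cdot> \<eta> 1 (j - 3)) \<squnion> \<delta> n (j + 1)
             + word [1] \<squnion> word [j + 1] \<cdot> \<eta> 2 (j - 1) \<squnion> \<delta> n (j + 2))) \<and>
     (3 \<le> j \<and> j = b + 1 \<and> a = b + 1 \<longrightarrow>
        S_star j \<sigma> =
          (-1) powi (n + j + 1) \<odot>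
            ((word [1] \<squnion> word [j - 1] \<cdot> \<eta> 2 (j - 2) - \<delta> (j - 1) (j - 2) \<cdot> \<eta> 1 (j - 3)) \<squnion> \<delta> n (j + 1))) \<and>
     (3 \<le> j \<and> j = b + 1 \<and> a \<ge> b + 2 \<longrightarrow>
        S_star j \<sigma> =
          (-1) powi (n + j + 1) \<odot>
            ((word [1] \<squnion> word [j - 1] \<cdot> \<eta> 2 (j - 2) - \<delta> (j - 1) (j - 2) \<cdot> \<eta> 1 (j - 3)) \<squnion> \<delta> n (j + 1)
             - word [j + 1, j - 1] \<cdot> \<eta> 1 (j - 2) \<squnion> \<delta> n (j + 2))) \<and>
     (b + 2 \<le> j \<and> j \<le> n \<and> j \<le> a - 1 \<longrightarrow>
        S_star j \<sigma> =
          (-1) powi (n + j) \<odot>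
            (word [j - 1, b] \<cdot> \<eta> 1 (b - 1) \<cdot> \<eta> (b + 1) (j - 2) \<squnion> \<delta> n (j + 1)
             + word [j + 1, b] \<cdot> \<eta> 1 (b - 1) \<cdot> \<eta> (b + 1) (j - 1) \<squnion> \<delta> n (j + 2))) \<and>
     (b + 2 \<le> j \<and> j \<le> n \<and> j = a \<longrightarrow>
        S_star j \<sigma> =
          (-1) powi (n + j) \<odot>
            (word [j - 1, b] \<cdot> \<eta> 1 (b - 1) \<cdot> \<eta> (b + 1) (j - 2) \<squnion> \<delta> n (j + 1))) \<and>
     (b + 2 \<le> j \<and> j \<le> n \<and> j \<ge> a + 1 \<longrightarrow> S_star j \<sigma> = 0) \<and>
     (1 \<le> j \<and> j \<le> b \<longrightarrow>
        (\<forall>a'. b < a' \<and> a' \<le> n \<longrightarrow> S_star j (sigma_A a' b n) = S_star j \<sigma>))"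
  unfolding \<sigma>
proof (intro conjI impI allI; elim conjE)
  show "S_star j (sigma_A a' b n :: 'k wvec) = S_star j (sigma_A a b n)"
    if "1 \<le> j" "j \<le> b" "b < a'" "a' \<le> n" for a'
    using that ab by (intro S_star_sigma_independent) auto
  show "S_star j (sigma_A a b n :: 'k wvec) = (- 1) powi n \<odot> (word [1] \<squnion> \<delta> n 3)"
    if "j = 2" "b = 1" "a = 2"
    using ab S_star_sigma_2_b_1[of a n, where 'k = 'k] unfolding that by simp
\<comment> \<open>Each remaining case fixes the conditions in one of the combined formulas.\<close>
qed (use ab j in \<open>simp_all add: S_star_sigma_1_b_1 S_star_sigma_1_b_2 S_star_sigma_1_b_ge_3
    S_star_sigma_2_b_1 S_star_sigma_2_b_ge_2 S_star_sigma_ge_3 S_star_sigma_ge_b_2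
    del: shuffle_word cat_word\<close>)

end
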